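(* (1) $\mathrm{Out}\,C_1^3\simeq GL_3(2)$; (2) $\mathrm{Out}\,C_2^3\simeq S_4$; (3) $\mathrm{Out}\,C_3^3\simeq S_4$; (4) $\mathrm{Out}\,C_4^3\simeq D_8$; (5) $\mathrm{Out}\,C_5^3\simeq S_3$.
   Context: For $u,v,w\in\mathbf F_2^m$ let $|v|$ be the number of coordinates equal to $1$, and $|u\cap v|$, $|u\cap v\cap w|$ the number of coordinates where all listed vectors equal $1$. A double even code is a subspace $V\subseteq\mathbf F_2^m$ with $|v|\equiv0\pmod 4$ and $|u\cap v|\equiv 0\pmod 2$ for all $u,v\in V$. There is a function $\phi:V\times V\to\{1,-1\}$ with $\phi(v,v)=(-1)^{|v|/4}$, $\phi(v,w)=(-1)^{|v\cap w|/2}\phi(w,v)$, $\phi(0,v)=\phi(v,0)=1$, $\phi(v+w,u)=\phi(v,w+u)\phi(v,w)\phi(w,u)(-1)^{|v\cap w\cap u|}$. The code loop $L(V)$ is the set $\{1,-1\}\times V$ with product $(\epsilon,v)(\delta,w)=(\epsilon\delta\,\phi(v,w),v+w)$; it is a Moufang loop, of rank $\dim_{\mathbf F_2}V$. A code loop is a loop isomorphic to some $L(V)$. Commutators: $[x,y]=x^{-1}y^{-1}xy$; associators: $(x,y,z)=((xy)z)(x(yz))^{-1}$. If $L$ is a nonassociative code loop of rank $3$ with generators $a,b,c$ (elements whose images form a basis of $L/\{\pm1\}$), then $(a,b,c)=-1$, and the characteristic vector with respect to $a,b,c$ is $(\lambda_1,\dots,\lambda_6)\in\mathbf F_2^6$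 with $a^2=(-1)^{\lambda_1}$, $b^2=(-1)^{\lambda_2}$, $c^2=(-1)^{\lambda_3}$, $[a,b]=(-1)^{\lambda_4}$, $[a,c]=(-1)^{\lambda_5}$, $[b,c]=(-1)^{\lambda_6}$. $C_1^3,\dots,C_5^3$ are the nonassociative code loops of rank $3$ with characteristic vectors $(111111)$, $(000000)$, $(000111)$, $(110000)$, $(100000)$ respectively (a characteristic vector determines the loop up to isomorphism). For a code loop $L$, $\mathrm{Out}\,L=\mathrm{Aut}\,L/N(\mathrm{Aut}\,L)$, where $N(\mathrm{Aut}\,L)=\{\phi\in\mathrm{Aut}\,L : \phi(x)=\pm x\ \forall x\in L\}$. $GL_3(2)$ is the general linear group over $\mathbf F_2$, $S_n$ the symmetric group on $n$ letters, $D_8$ the dihedral group of order $8$. *)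

theory Defs
  imports
    "HOL-Analysis.Analysis"
    "HOL-Library.Z2"
    "HOL-Algebra.Coset"
    "HOL-Algebra.Bij"
    "HOL-Algebra.Sym_Groups"
begin

text \<open>
  Loops (in general nonassociative) are represented by the monoid records of HOL-Algebra, whose
  notions of homomorphism, isomorphism, automorphism group, inverse and quotient do not presuppose
  associativity. Vectors over the two-element field are elements of \<open>bit ^ 'm\<close>.
\<close>

locale loop =
  fixes L (structure)
  assumes mult_closed: "\<lbrakk>x \<in> carrier L; y \<in> carrier L\<rbrakk> \<Longrightarrow> x \<otimes> y \<in> carrier L"
    and one_closed: "\<one> \<in> carrier L"
    and left_one: "x \<in> carrier L \<Longrightarrow> \<one> \<otimes> x = x"
    and right_one: "x \<in> carrier L \<Longrightarrow> x \<otimes> \<one> = x"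
    and left_division: "\<lbrakk>a \<in> carrier L; b \<in> carrier L\<rbrakk> \<Longrightarrow> \<exists>!x. x \<in> carrier L \<and> a \<otimes> x = b"
    and right_division: "\<lbrakk>a \<in> carrier L; b \<in> carrier L\<rbrakk> \<Longrightarrow> \<exists>!y. y \<in> carrier L \<and> y \<otimes> a = b"

definition nonassociative :: "('a, 'b) monoid_scheme \<Rightarrow> bool" where
  "nonassociative L \<longleftrightarrow>
     (\<exists>x\<in>carrier L. \<exists>y\<in>carrier L. \<exists>z\<in>carrier L.
        (x \<otimes>\<^bsub>L\<^esub> y) \<otimes>\<^bsub>L\<^esub> z \<noteq> x \<otimes>\<^bsub>L\<^esub> (y \<otimes>\<^bsub>L\<^esub> z))"

text \<open>The bracketing is immaterial in code loops, any two elements of which generate a group.\<close>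

definition commutator :: "('a, 'b) monoid_scheme \<Rightarrow> 'a \<Rightarrow> 'a \<Rightarrow> 'a" where
  "commutator L x y = ((inv\<^bsub>L\<^esub> x \<otimes>\<^bsub>L\<^esub> inv\<^bsub>L\<^esub> y) \<otimes>\<^bsub>L\<^esub> x) \<otimes>\<^bsub>L\<^esub> y"

definition supp :: "bit ^ 'm \<Rightarrow> 'm set" where
  "supp v = {i. v $ i = 1}"

definition double_even_code :: "(bit ^ 'm) set \<Rightarrow> bool" where
  "double_even_code V \<longleftrightarrow>
     vec.subspace V \<and>
     (\<forall>v\<in>V. 4 dvd card (supp v)) \<and>
     (\<forall>u\<in>V. \<forall>v\<in>V. 2 dvd card (supp u \<inter> supp v))"

definition factor_set :: "(bit ^ 'm) set \<Rightarrow> (bit ^ 'm \<Rightarrow> bit ^ 'm \<Rightarrow> int) \<Rightarrow> bool" where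
  "factor_set V \<phi> \<longleftrightarrow>
     (\<forall>v\<in>V. \<forall>w\<in>V. \<phi> v w \<in> {1, -1}) \<and>
     (\<forall>v\<in>V. \<phi> v v = (-1) ^ (card (supp v) div 4)) \<and>
     (\<forall>v\<in>V. \<forall>w\<in>V. \<phi> v w = (-1) ^ (card (supp v \<inter> supp w) div 2) * \<phi> w v) \<and>
     (\<forall>v\<in>V. \<phi> 0 v = 1 \<and> \<phi> v 0 = 1) \<and>
     (\<forall>v\<in>V. \<forall>w\<in>V. \<forall>u\<in>V.
        \<phi> (v + w) u =
          \<phi> v (w + u) * \<phi> v w * \<phi> w u * (-1) ^ card (supp v \<inter> supp w \<inter> supp u))"

definition loop_of_code ::
    "(bit ^ 'm) set \<Rightarrow> (bit ^ 'm \<Rightarrow> bit ^ 'm \<Rightarrow> int) \<Rightarrow> (int \<times> (bit ^ 'm)) monoid" where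
  "loop_of_code V \<phi> =
     \<lparr>carrier = {1, -1} \<times> V,
      mult = (\<lambda>(\<epsilon>, v) (\<delta>, w). (\<epsilon> * \<delta> * \<phi> v w, v + w)),
      one = (1, 0)\<rparr>"

text \<open>
  \<open>code_loop V L z\<close>: the loop \<open>L\<close> is isomorphic to the code loop of \<open>V\<close>, and \<open>z\<close> is
  the element of \<open>L\<close> that plays the role of \<open>-1\<close>.
\<close>

definition code_loop :: "(bit ^ 'm) set \<Rightarrow> ('a, 'b) monoid_scheme \<Rightarrow> 'a \<Rightarrow> bool" where
  "code_loop V L z \<longleftrightarrow>
     loop L \<and> double_even_code V \<and>
     (\<exists>\<phi> h. factor_set V \<phi> \<and> h \<in> iso (loop_of_code V \<phi>) L \<and> h (-1, 0) = z)"

text \<open>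
  The quotient \<open>L / {\<plusminus>1}\<close> is an elementary abelian 2-group, i.e. a vector space over the
  two-element field in multiplicative notation: a linear combination of \<open>A, B, C\<close> with
  coefficients \<open>i, j, k\<close> is the product of the powers with exponents \<open>i, j, k\<close>. Being a basis
  means that every element is such a combination for exactly one choice of coefficients.
\<close>

definition generators3 :: "('a, 'b) monoid_scheme \<Rightarrow> 'a \<Rightarrow> 'a \<Rightarrow> 'a \<Rightarrow> 'a \<Rightarrow> bool" where
  "generators3 L z a b c \<longleftrightarrow>
     a \<in> carrier L \<and> b \<in> carrier L \<and> c \<in> carrier L \<and>
     (let Z = {\<one>\<^bsub>L\<^esub>, z}; Q = L Mod Z;
          A = Z #>\<^bsub>L\<^esub> a; B = Z #>\<^bsub>L\<^esub> b; C = Z #>\<^bsub>L\<^esub> c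
      in bij_betw
           (\<lambda>(i, j, k). (A [^]\<^bsub>Q\<^esub> i \<otimes>\<^bsub>Q\<^esub> B [^]\<^bsub>Q\<^esub> j) \<otimes>\<^bsub>Q\<^esub> C [^]\<^bsub>Q\<^esub> k)
           ({0, 1 :: nat} \<times> {0, 1 :: nat} \<times> {0, 1 :: nat})
           (carrier Q))"

definition neg_one_power :: "('a, 'b) monoid_scheme \<Rightarrow> 'a \<Rightarrow> bit \<Rightarrow> 'a" where
  "neg_one_power L z e = (if e = 1 then z else \<one>\<^bsub>L\<^esub>)"

fun has_characteristic_vector ::
    "('a, 'b) monoid_scheme \<Rightarrow> 'a \<Rightarrow> 'a \<Rightarrow> 'a \<Rightarrow> 'a \<Rightarrow> bit \<times> bit \<times> bit \<times> bit \<times> bit \<times> bit \<Rightarrow> bool"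
  where
  "has_characteristic_vector L z a b c (l1, l2, l3, l4, l5, l6) \<longleftrightarrow>
     a \<otimes>\<^bsub>L\<^esub> a = neg_one_power L z l1 \<and>
     b \<otimes>\<^bsub>L\<^esub> b = neg_one_power L z l2 \<and>
     c \<otimes>\<^bsub>L\<^esub> c = neg_one_power L z l3 \<and>
     commutator L a b = neg_one_power L z l4 \<and>
     commutator L a c = neg_one_power L z l5 \<and>
     commutator L b c = neg_one_power L z l6"

definition nonassoc_code_loop_rank3 ::
    "bit \<times> bit \<times> bit \<times> bit \<times> bit \<times> bit \<Rightarrow> (bit ^ 'm) set \<Rightarrow> ('a, 'b) monoid_scheme \<Rightarrow> 'a \<Rightarrow> bool"
  where
  "nonassoc_code_loop_rank3 l V L z \<longleftrightarrow>
     code_loop V L z \<and> vec.dim V = 3 \<and> nonassociative L \<and>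
     (\<exists>a b c. generators3 L z a b c \<and> has_characteristic_vector L z a b c l)"

abbreviation "C3_1 \<equiv> nonassoc_code_loop_rank3 (1, 1, 1, 1, 1, 1)"
abbreviation "C3_2 \<equiv> nonassoc_code_loop_rank3 (0, 0, 0, 0, 0, 0)"
abbreviation "C3_3 \<equiv> nonassoc_code_loop_rank3 (0, 0, 0, 1, 1, 1)"
abbreviation "C3_4 \<equiv> nonassoc_code_loop_rank3 (1, 1, 0, 0, 0, 0)"
abbreviation "C3_5 \<equiv> nonassoc_code_loop_rank3 (1, 0, 0, 0, 0, 0)"

definition sign_automorphisms :: "('a, 'b) monoid_scheme \<Rightarrow> 'a \<Rightarrow> ('a \<Rightarrow> 'a) set" where
  "sign_automorphisms L z =
     {f \<in> auto L. \<forall>x\<in>carrier L. f x = x \<or> f x = z \<otimes>\<^bsub>L\<^esub> x}"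

definition Out :: "('a, 'b) monoid_scheme \<Rightarrow> 'a \<Rightarrow> ('a \<Rightarrow> 'a) set monoid" where
  "Out L z = AutoGroup L Mod sign_automorphisms L z"

definition GL3_2 :: "(bit ^ 3 ^ 3) monoid" where
  "GL3_2 = \<lparr>carrier = {A. invertible A}, mult = (**), one = mat 1\<rparr>"

text \<open>
  The dihedral group of order \<open>2 * n\<close>; \<open>(i, s)\<close> stands for the symmetry
  \<open>x \<mapsto> i \<plusminus> x\<close> of the \<open>n\<close>-gon with vertices the integers modulo \<open>n\<close>,
  with sign \<open>-\<close> iff \<open>s\<close>.
\<close>

definition dihedral_group :: "nat \<Rightarrow> (int \<times> bool) monoid" where
  "dihedral_group n =
     \<lparr>carrier = {0..<int n} \<times> UNIV,
      mult = (\<lambda>(i, s) (j, t). ((i + (if s then - j else j)) mod int n, s \<noteq> t)),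
      one = (0, False)\<rparr>"

end

theory Submission
  imports Defs
begin

text \<open>
  An automorphism of a nonassociative code loop fixes \<open>-1\<close>, the only nontrivial associator, so it
  induces a linear automorphism of \<open>V\<close> that preserves the squaring map \<open>q v = |v|/4\<close>.
  Conversely, let \<open>g\<close> be a linear automorphism of \<open>V\<close> with \<open>q \<circ> g = q\<close>. By polarization \<open>g\<close>
  also preserves commutators and associators, so the factor sets \<open>\<phi>\<close> and \<open>\<phi> \<circ> (g \<times> g)\<close> differ by
  a symmetric cocycle that is trivial on the diagonal. Such a cocycle is a coboundary, and \<open>g\<close>
  lifts to the loop. Hence \<open>Out L\<close> is the stabilizer of the cubic form \<open>q\<close> in \<open>GL\<^sub>3(2)\<close>.

  In coordinates \<open>q\<close> is \<open>x y z\<close> plus the quadratic terms given by the characteristic vector. In the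
  five cases its stabilizer is all of \<open>GL\<^sub>3(2)\<close>, the stabilizer of the vector \<open>111\<close>, and the
  stabilizers of the sets \<open>{100, 010, 001, 111}\<close>, \<open>{110, 001}\<close> and \<open>{100, 110, 101}\<close>.
\<close>

section \<open>Stabilizers of cubic forms\<close>

declare add_bit_eq_xor [simp del] mult_bit_eq_and [simp del]

lemma bit_add_self [simp]: "x + x = (0 :: bit)"
  by (cases x) simp_all

lemma all_bit_iff: "(\<forall>x::bit. P x) \<longleftrightarrow> P 0 \<and> P 1"
  by (metis bit_not_one_iff)

lemma bit_vec_add_self [simp]: "v + v = (0 :: bit ^ 'n)"
  by (simp add: vec_eq_iff)

lemma bit_vec_add_left_cancel [simp]: "v + (v + w) = (w :: bit ^ 'n)"
  by (simp flip: add.assoc)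

lemma bit_vec_add_eq_0_iff: "v + w = 0 \<longleftrightarrow> v = (w :: bit ^ 'n)"
  by (metis bit_vec_add_left_cancel add.right_neutral bit_vec_add_self)

definition of_columns :: "'a :: zero ^ 3 \<Rightarrow> 'a ^ 3 \<Rightarrow> 'a ^ 3 \<Rightarrow> 'a ^ 3 ^ 3" where
  "of_columns u v w = transpose (vector [u, v, w])"

lemma of_columns_mult_vec:
  fixes u v w x :: "'a :: field ^ 3"
  shows "of_columns u v w *v x = x $ 1 *s u + x $ 2 *s v + x $ 3 *s w"
  by (simp add: of_columns_def vec_eq_iff matrix_vector_mult_def transpose_def sum_3 forall_3
      algebra_simps)

lemma eq_of_columns_iff:
  fixes A :: "'a :: field ^ 3 ^ 3"
  shows "A = of_columns u v w \<longleftrightarrow>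
    A *v vector [1, 0, 0] = u \<and> A *v vector [0, 1, 0] = v \<and> A *v vector [0, 0, 1] = w"
  by (auto simp: of_columns_def vec_eq_iff matrix_vector_mult_def transpose_def sum_3 forall_3)

lemma mult_of_columns:
  fixes A :: "'a :: field ^ 3 ^ 3"
  shows "A ** of_columns u v w = of_columns (A *v u) (A *v v) (A *v w)"
  by (simp add: eq_of_columns_iff of_columns_mult_vec flip: matrix_vector_mul_assoc)

lemma of_columns_eq_iff:
  fixes u v w :: "'a :: field ^ 3"
  shows "of_columns u v w = of_columns u' v' w' \<longleftrightarrow> u = u' \<and> v = v' \<and> w = w'"
  by (auto simp: eq_of_columns_iff of_columns_mult_vec)

lemma matrix_3_eqI:
  fixes A B :: "'a :: field ^ 3 ^ 3"
  assumes "A *v vector [1, 0, 0] = B *v vector [1, 0, 0]"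
    and "A *v vector [0, 1, 0] = B *v vector [0, 1, 0]"
    and "A *v vector [0, 0, 1] = B *v vector [0, 0, 1]"
  shows "A = B"
  using assms eq_of_columns_iff by metis

section \<open>Cubic forms and their stabilizers in GL_3(2)\<close>

lemma invertible_mat_1: "invertible (mat 1 :: 'a :: semiring_1 ^ 'n ^ 'n)"
  unfolding invertible_def by (metis matrix_mul_lid)

lemma group_GL3_2: "group GL3_2"
proof (rule groupI)
  fix A assume "A \<in> carrier GL3_2"
  then obtain B where "A ** B = mat 1" "B ** A = mat 1"
    by (auto simp: GL3_2_def invertible_def)
  then show "\<exists>B\<in>carrier GL3_2. B \<otimes>\<^bsub>GL3_2\<^esub> A = \<one>\<^bsub>GL3_2\<^esub>"
    by (auto simp: GL3_2_def invertible_def)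
qed (auto simp: GL3_2_def matrix_mul_assoc invertible_mult invertible_mat_1)

text \<open>This is the squaring map in coordinates: the linear coefficients are the squares of the
  generators, the quadratic ones their commutators, and the coefficient 1 of the cubic term is their
  associator.\<close>

fun cubic_form :: "bit \<times> bit \<times> bit \<times> bit \<times> bit \<times> bit \<Rightarrow> bit ^ 3 \<Rightarrow> bit" where
  "cubic_form (l1, l2, l3, l4, l5, l6) x =
     l1 * x $ 1 + l2 * x $ 2 + l3 * x $ 3 +
     l4 * x $ 1 * x $ 2 + l5 * x $ 1 * x $ 3 + l6 * x $ 2 * x $ 3 + x $ 1 * x $ 2 * x $ 3"

text \<open>Replacing only the carrier of \<open>GL3_2\<close> keeps its operations, so a form
  preserved by every invertible matrix yields an equality of records.\<close>

definition form_group :: "bit \<times> bit \<times> bit \<times> bit \<times> bit \<times> bit \<Rightarrow> (bit ^ 3 ^ 3) monoid" where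
  "form_group l =
     GL3_2\<lparr>carrier := {A. invertible A \<and> (\<forall>x. cubic_form l (A *v x) = cubic_form l x)}\<rparr>"

lemma form_group_simps [simp]:
  "A \<in> carrier (form_group l) \<longleftrightarrow>
     invertible A \<and> (\<forall>x. cubic_form l (A *v x) = cubic_form l x)"
  "mult (form_group l) = (**)" "one (form_group l) = mat 1"
  by (simp_all add: form_group_def GL3_2_def)

lemma group_form_group: "group (form_group l)"
proof (rule groupI)
  fix A assume A: "A \<in> carrier (form_group l)"
  then obtain B where B: "A ** B = mat 1" "B ** A = mat 1"
    by (auto simp: invertible_def)
  have "cubic_form l (B *v x) = cubic_form l x" for x
  proof -
    have "cubic_form l (B *v x) = cubic_form l (A *v (B *v x))"
      using A by simp
    then show ?thesis
      by (simp add: matrix_vector_mul_assoc B)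
  qed
  with B show "\<exists>B\<in>carrier (form_group l). B \<otimes>\<^bsub>form_group l\<^esub> A = \<one>\<^bsub>form_group l\<^esub>"
    by (intro bexI[of _ B]) (auto simp: invertible_def)
qed (auto simp: matrix_mul_assoc invertible_mult invertible_mat_1 simp flip: matrix_vector_mul_assoc)

lemma invertible_mult_vec_eq_0_iff:
  fixes A :: "'a :: field ^ 'n ^ 'n"
  assumes "invertible A"
  shows "A *v x = 0 \<longleftrightarrow> x = 0"
  using assms by (metis invertible_def matrix_left_invertible_ker matrix_vector_mult_0_right)

lemma bit_vec3_eq_0_iff: "x = 0 \<longleftrightarrow> x $ 1 = 0 \<and> x $ 2 = 0 \<and> x $ 3 = 0"
  for x :: "'a :: zero ^ 3"
  by (simp add: vec_eq_iff forall_3)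

text \<open>With all coefficients 1 the form is \<open>1 + (1 + x) * (1 + y) * (1 + z)\<close>, the
  indicator of the nonzero vectors.\<close>

lemma form_group_111111: "form_group (1, 1, 1, 1, 1, 1) = GL3_2"
proof -
  have *: "cubic_form (1, 1, 1, 1, 1, 1) x = of_bool (x \<noteq> 0)" for x
    unfolding bit_vec3_eq_0_iff
    by (cases "x $ 1"; cases "x $ 2"; cases "x $ 3") simp_all
  show ?thesis
    unfolding form_group_def * by (simp add: GL3_2_def invertible_mult_vec_eq_0_iff cong: conj_cong)
qed

text \<open>A frame is a spanning set of vectors all of whose permutations are induced by matrices.\<close>

lemma frame_stabilizer_iso_sym_group:
  fixes s :: "nat \<Rightarrow> bit ^ 3"
  assumes inj: "inj_on s {1..n}"
    and unique: "\<And>A B :: bit ^ 3 ^ 3. (\<And>i. i \<in> {1..n} \<Longrightarrow> A *v s i = B *v s i) \<Longrightarrow> A = B"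
    and ext: "\<And>p. p permutes {1..n} \<Longrightarrow> \<exists>A. \<forall>i\<in>{1..n}. A *v s i = s (p i)"
    and stab: "\<And>A. invertible A \<Longrightarrow>
      (\<forall>x. cubic_form l (A *v x) = cubic_form l x) \<longleftrightarrow> (\<forall>x. A *v x \<in> s ` {1..n} \<longleftrightarrow> x \<in> s ` {1..n})"
  shows "form_group l \<cong> sym_group n"
proof -
  \<comment> \<open>Choose a matrix for each permutation. A matrix is determined by its values on
    the frame, so the choice is forced and therefore multiplicative.\<close>
  obtain \<rho> where \<rho>: "\<And>p i. p permutes {1..n} \<Longrightarrow> i \<in> {1..n} \<Longrightarrow> \<rho> p *v s i = s (p i)"
  proof -
    have "\<forall>p. \<exists>A. p permutes {1..n} \<longrightarrow> (\<forall>i\<in>{1..n}. A *v s i = s (p i))"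
      using ext by blast
    then show ?thesis
      using that by (metis choice)
  qed
  have in_range: "p i \<in> {1..n}" if "p permutes {1..n}" "i \<in> {1..n}" for p i
    using that by (simp only: permutes_in_image)
  have mult: "\<rho> (p \<circ> q) = \<rho> p ** \<rho> q" if p: "p permutes {1..n}" and q: "q permutes {1..n}" for p q
  proof (rule unique)
    fix i assume i: "i \<in> {1..n}"
    show "\<rho> (p \<circ> q) *v s i = (\<rho> p ** \<rho> q) *v s i"
      by (simp only: \<rho>[OF permutes_compose[OF q p] i] \<rho>[OF q i] \<rho>[OF p in_range[OF q i]] o_apply
          matrix_vector_mul_assoc[symmetric])
  qed
  have one: "\<rho> id = mat 1"
    by (rule unique) (simp only: \<rho>[OF permutes_id] matrix_vector_mul_lid id_apply)
  have inv: "\<rho> p ** \<rho> (inv' p) = mat 1" "\<rho> (inv' p) ** \<rho> p = mat 1"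
    if p: "p permutes {1..n}" for p
    using mult[OF p permutes_inv[OF p]] mult[OF permutes_inv[OF p] p]
    by (simp_all only: permutes_inv_o[OF p] one)
  have img: "\<rho> p *v x \<in> s ` {1..n}" if p: "p permutes {1..n}" and x: "x \<in> s ` {1..n}" for p x
  proof -
    obtain i where i: "i \<in> {1..n}" "x = s i" using x by blast
    show ?thesis
      unfolding i(2) \<rho>[OF p i(1)] using in_range[OF p i(1)] by (rule imageI)
  qed
  have carrier: "\<rho> p \<in> carrier (form_group l)" if p: "p permutes {1..n}" for p
  proof -
    have invertible: "invertible (\<rho> p)"
      using inv[OF p] unfolding invertible_def by blast
    moreover have "\<rho> p *v x \<in> s ` {1..n} \<longleftrightarrow> x \<in> s ` {1..n}" for x
    proof
      assume "\<rho> p *v x \<in> s ` {1..n}"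
      then have "\<rho> (inv' p) *v (\<rho> p *v x) \<in> s ` {1..n}"
        by (rule img[OF permutes_inv[OF p]])
      then show "x \<in> s ` {1..n}"
        by (simp only: matrix_vector_mul_assoc inv[OF p] matrix_vector_mul_lid)
    qed (rule img[OF p])
    ultimately show ?thesis
      unfolding form_group_simps using stab by blast
  qed
  have inj_\<rho>: "p = q" if p: "p permutes {1..n}" and q: "q permutes {1..n}" and eq: "\<rho> p = \<rho> q" for p q
  proof
    fix i
    show "p i = q i"
    proof (cases "i \<in> {1..n}")
      case True
      then have "s (p i) = s (q i)"
        using \<rho>[OF p True] \<rho>[OF q True] eq by simp
      then show ?thesis
        using inj in_range[OF p True] in_range[OF q True] by (simp only: inj_on_eq_iff)
    next
      case False
      then show ?thesis
        using permutes_not_in[OF p False] permutes_not_in[OF q False] by simp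
    qed
  qed
  have surj: "A \<in> \<rho> ` {p. p permutes {1..n}}" if A: "A \<in> carrier (form_group l)" for A
  proof -
    \<comment> \<open>Conversely, a stabilizing matrix permutes the frame. The permutation read off
      from it is the identity outside \<open>{1..n}\<close>, as \<open>permutes\<close>
      demands.\<close>
    define p where "p = (\<lambda>i. if i \<in> {1..n} then inv_into {1..n} s (A *v s i) else i)"
    have As: "A *v s i \<in> s ` {1..n}" if "i \<in> {1..n}" for i
      using A stab[of A] that unfolding form_group_simps by blast
    have p: "s (p i) = A *v s i" "p i \<in> {1..n}" if "i \<in> {1..n}" for i
      using f_inv_into_f[OF As[OF that]] inv_into_into[OF As[OF that]] that
      by (simp_all only: p_def if_True)
    have "inj ((*v) A)"
      using A unfolding form_group_simps invertible_def matrix_left_invertible_injective[symmetric]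
      by blast
    then have inj_p: "inj_on p {1..n}"
    proof (intro inj_onI)
      fix i j assume ij: "i \<in> {1..n}" "j \<in> {1..n}" "p i = p j"
      then have "A *v s i = A *v s j"
        using p(1)[of i] p(1)[of j] by simp
      then show "i = j"
        using \<open>inj ((*v) A)\<close> inj ij by (simp only: inj_eq inj_on_eq_iff)
    qed
    moreover have "p ` {1..n} = {1..n}"
      by (rule endo_inj_surj[OF _ _ inj_p]) (use p(2) in blast)+
    ultimately have perm: "p permutes {1..n}"
      by (intro bij_imp_permutes) (auto simp: bij_betw_def p_def)
    have "A = \<rho> p"
      by (rule unique) (simp only: \<rho>[OF perm] p)
    with perm show ?thesis by blast
  qed
  have "\<rho> \<in> iso (sym_group n) (form_group l)"
    unfolding iso_def bij_betw_def
  proof (intro IntI CollectI conjI homI)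
    show "\<rho> ` carrier (sym_group n) = carrier (form_group l)"
      unfolding sym_group_def using carrier surj by auto
    show "inj_on \<rho> (carrier (sym_group n))"
      unfolding sym_group_def using inj_\<rho> by (intro inj_onI) simp
  qed (use carrier mult in \<open>simp_all add: sym_group_def del: form_group_simps(1)\<close>)
  then show ?thesis
    using group.iso_sym[OF sym_group_is_group] is_iso_def by blast
qed

section \<open>Stabilizers of the remaining four forms\<close>

lemma atLeastAtMost_1_3: "{1..3} = {1, 2, 3 :: nat}" and atLeastAtMost_1_4: "{1..4} = {1, 2, 3, 4 :: nat}"
  by auto

lemma forall_bit_vec3: "(\<forall>x :: bit ^ 3. P x) \<longleftrightarrow> (\<forall>i j k. P (vector [i, j, k]))"
  by (rule forall_vector_3)

lemma vector_3_eq_iff: "vector [i, j, k] = (vector [i', j', k'] :: 'a :: zero ^ 3) \<longleftrightarrow> i = i' \<and> j = j' \<and> k = k'"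
  by (auto simp: vec_eq_iff forall_3)

text \<open>The nonzero zeros of this form are the three unit vectors and their sum. Any three of
  them are a basis and all four add up to 0, so they are a frame.\<close>

lemma form_group_000111: "form_group (0, 0, 0, 1, 1, 1) \<cong> sym_group 4"
proof -
  define s :: "nat \<Rightarrow> bit ^ 3" where
    "s i = (if i = 1 then vector [1, 0, 0] else if i = 2 then vector [0, 1, 0]
            else if i = 3 then vector [0, 0, 1] else vector [1, 1, 1])" for i
  have S: "s ` {1..4} = {vector [1, 0, 0], vector [0, 1, 0], vector [0, 0, 1], vector [1, 1, 1]}"
    unfolding atLeastAtMost_1_4 by (auto simp: s_def)
  have form: "cubic_form (0, 0, 0, 1, 1, 1) x = of_bool (x \<noteq> 0 \<and> x \<notin> s ` {1..4})" for x
    apply (rule spec[of _ x])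
    unfolding forall_bit_vec3 all_bit_iff S
    by (simp add: vector_3_eq_iff vec_eq_iff[of _ 0] forall_3)
  have s0: "0 \<notin> s ` {1..4}"
    unfolding S by (simp add: vec_eq_iff forall_3)
  show ?thesis
  proof (rule frame_stabilizer_iso_sym_group[of s])
    show "inj_on s {1..4}"
      unfolding atLeastAtMost_1_4 by (simp add: s_def vector_3_eq_iff)
  next
    fix A B :: "bit ^ 3 ^ 3"
    assume "\<And>i. i \<in> {1..4} \<Longrightarrow> A *v s i = B *v s i"
    from this[of 1] this[of 2] this[of 3] show "A = B"
      unfolding s_def by (intro matrix_3_eqI) simp_all
  next
    fix p :: "nat \<Rightarrow> nat" assume p: "p permutes {1..4}"
    \<comment> \<open>The only linear relation among the four vectors is that their sum vanishes,
      and it is invariant under permutations. Hence the matrix with the first three images as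
      columns also sends the fourth vector to its image.\<close>
    have "(\<Sum>i\<in>{1..4}. s (p i)) = (\<Sum>i\<in>{1..4}. s i)"
      using sum.permute[OF p, of s] by (simp add: o_def)
    also have "\<dots> = 0"
      unfolding atLeastAtMost_1_4 by (simp add: s_def vec_eq_iff forall_3)
    finally have "s (p 1) + s (p 2) + s (p 3) + s (p 4) = 0"
      unfolding atLeastAtMost_1_4 by (simp add: add_ac)
    then have "s (p 1) + s (p 2) + s (p 3) = s (p 4)"
      by (simp only: bit_vec_add_eq_0_iff)
    \<comment> \<open>Unfolding \<open>s\<close> only at the literal indices keeps the terms
      \<open>s (p i)\<close> folded.\<close>
    then have "\<forall>i\<in>{1..4}. of_columns (s (p 1)) (s (p 2)) (s (p 3)) *v s i = s (p i)"
      unfolding atLeastAtMost_1_4 by (simp add: of_columns_mult_vec s_def[of "Suc 0"] s_def[of 2] s_def[of 3] s_def[of 4])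
    then show "\<exists>A. \<forall>i\<in>{1..4}. A *v s i = s (p i)" ..
  next
    fix A :: "bit ^ 3 ^ 3" assume "invertible A"
    then show "(\<forall>x. cubic_form (0, 0, 0, 1, 1, 1) (A *v x) = cubic_form (0, 0, 0, 1, 1, 1) x) \<longleftrightarrow>
      (\<forall>x. A *v x \<in> s ` {1..4} \<longleftrightarrow> x \<in> s ` {1..4})"
      unfolding form using s0 invertible_mult_vec_eq_0_iff by (auto simp: of_bool_eq_iff)
  qed
qed

text \<open>The form \<open>x + x * y * z\<close> is the indicator of 100, 110 and 101. These form a
  basis, so each permutation of them is induced by exactly one matrix.\<close>

lemma form_group_100000: "form_group (1, 0, 0, 0, 0, 0) \<cong> sym_group 3"
proof -
  define s :: "nat \<Rightarrow> bit ^ 3" where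
    "s i = (if i = 1 then vector [1, 0, 0] else if i = 2 then vector [1, 1, 0]
            else vector [1, 0, 1])" for i
  have S: "s ` {1..3} = {vector [1, 0, 0], vector [1, 1, 0], vector [1, 0, 1]}"
    unfolding atLeastAtMost_1_3 by (auto simp: s_def)
  have form: "cubic_form (1, 0, 0, 0, 0, 0) x = of_bool (x \<in> s ` {1..3})" for x
    apply (rule spec[of _ x])
    unfolding forall_bit_vec3 all_bit_iff S
    by (simp add: vector_3_eq_iff)
  show ?thesis
  proof (rule frame_stabilizer_iso_sym_group[of s])
    show "inj_on s {1..3}"
      unfolding atLeastAtMost_1_3 by (simp add: s_def vector_3_eq_iff)
  next
    fix A B :: "bit ^ 3 ^ 3"
    assume AB: "\<And>i. i \<in> {1..3} \<Longrightarrow> A *v s i = B *v s i"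
    have *: "vector [0, 1, 0] = s 1 + s 2" "vector [0, 0, 1] = s 1 + s 3" "vector [1, 0, 0] = s 1"
      by (simp_all add: s_def vec_eq_iff forall_3)
    show "A = B"
      by (rule matrix_3_eqI) (simp_all add: * matrix_vector_right_distrib AB)
  next
    fix p :: "nat \<Rightarrow> nat" assume p: "p permutes {1..3}"
    \<comment> \<open>The columns are the images of the unit vectors, which in terms of the frame
      are \<open>s 1\<close>, \<open>s 1 + s 2\<close> and \<open>s 1 + s 3\<close>.\<close>
    have "\<forall>i\<in>{1..3}. of_columns (s (p 1)) (s (p 1) + s (p 2)) (s (p 1) + s (p 3)) *v s i = s (p i)"
      unfolding atLeastAtMost_1_3 by (simp add: of_columns_mult_vec s_def[of "Suc 0"] s_def[of 2] s_def[of 3])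
    then show "\<exists>A. \<forall>i\<in>{1..3}. A *v s i = s (p i)" ..
  qed (simp only: form of_bool_eq_iff)
qed

text \<open>The contragredient representation exchanges the stabilizers of a vector and of a plane.\<close>

lemma form_group_000000_iso: "form_group (0, 0, 0, 0, 0, 0) \<cong> form_group (0, 0, 0, 1, 1, 1)"
proof -
  let ?u = "vector [1, 1, 1] :: bit ^ 3"
  \<comment> \<open>The form \<open>x * y * z\<close> is the indicator of 111, so its stabilizer is
    that of this vector.\<close>
  have mem2: "A \<in> carrier (form_group (0, 0, 0, 0, 0, 0)) \<longleftrightarrow> invertible A \<and> A *v ?u = ?u" for A
  proof -
    have *: "cubic_form (0, 0, 0, 0, 0, 0) x = of_bool (x = ?u)" for x
      apply (rule spec[of _ x])
      unfolding forall_bit_vec3 all_bit_iff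
      by (simp add: vector_3_eq_iff)
    have inj: "A *v x = ?u \<longleftrightarrow> x = ?u" if "invertible A" "A *v ?u = ?u" for x
      using that unfolding invertible_def by (metis matrix_left_invertible_injective injD)
    show ?thesis
      unfolding form_group_simps * of_bool_eq_iff using inj by blast
  qed
  \<comment> \<open>This form is the indicator of the nonzero vectors of the plane
    \<open>x + y + z = 0\<close>. Over F_2 an invertible matrix preserves the plane iff it preserves
    the functional \<open>x + y + z\<close>, and matrices act on functionals by their
    transposes.\<close>
  have mem3: "A \<in> carrier (form_group (0, 0, 0, 1, 1, 1)) \<longleftrightarrow> invertible A \<and> transpose A *v ?u = ?u" for A
  proof -
    have *: "cubic_form (0, 0, 0, 1, 1, 1) x = of_bool (x \<noteq> 0 \<and> x $ 1 + x $ 2 + x $ 3 = 0)" for x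
      apply (rule spec[of _ x])
      unfolding forall_bit_vec3 all_bit_iff
      by (simp add: vec_eq_iff forall_3)
    have form: "cubic_form (0, 0, 0, 1, 1, 1) (A *v x) = cubic_form (0, 0, 0, 1, 1, 1) x \<longleftrightarrow>
        (A *v x) $ 1 + (A *v x) $ 2 + (A *v x) $ 3 = x $ 1 + x $ 2 + x $ 3" if "invertible A" for x
    proof (cases "x = 0")
      case False
      then show ?thesis
        unfolding * of_bool_eq_iff invertible_mult_vec_eq_0_iff[OF that]
        by (cases "(A *v x) $ 1 + (A *v x) $ 2 + (A *v x) $ 3"; cases "x $ 1 + x $ 2 + x $ 3") simp_all
    qed simp
    have sum: "(A *v x) $ 1 + (A *v x) $ 2 + (A *v x) $ 3 =
        (transpose A *v ?u) $ 1 * x $ 1 + (transpose A *v ?u) $ 2 * x $ 2 + (transpose A *v ?u) $ 3 * x $ 3" for x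
      by (simp add: matrix_vector_mult_def transpose_def sum_3 algebra_simps)
    have "(\<forall>x. (A *v x) $ 1 + (A *v x) $ 2 + (A *v x) $ 3 = x $ 1 + x $ 2 + x $ 3)
      \<longleftrightarrow> transpose A *v ?u = ?u" (is "?L \<longleftrightarrow> ?R")
    proof
      assume L: ?L
      show ?R
        using L[unfolded sum, rule_format, of "vector [1, 0, 0]"]
          L[unfolded sum, rule_format, of "vector [0, 1, 0]"]
          L[unfolded sum, rule_format, of "vector [0, 0, 1]"]
        by (simp add: vec_eq_iff forall_3)
    qed (simp add: sum)
    then show ?thesis
      unfolding form_group_simps using form by blast
  qed
  \<comment> \<open>The inverse transpose is an involutive automorphism of \<open>GL3_2\<close> that
    exchanges the conditions \<open>A *v ?u = ?u\<close> and
    \<open>transpose A *v ?u = ?u\<close>.\<close>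
  define f :: "bit ^ 3 ^ 3 \<Rightarrow> bit ^ 3 ^ 3" where "f A = transpose (inv\<^bsub>GL3_2\<^esub> A)" for A
  interpret GL: group GL3_2 by (rule group_GL3_2)
  have carrier: "A \<in> carrier GL3_2 \<longleftrightarrow> invertible A" for A
    by (simp add: GL3_2_def)
  have inv: "inv\<^bsub>GL3_2\<^esub> A ** A = mat 1" "A ** inv\<^bsub>GL3_2\<^esub> A = mat 1" if "invertible A" for A
    using GL.l_inv[of A] GL.r_inv[of A] that by (simp_all add: GL3_2_def)
  have f_inv: "transpose A ** f A = mat 1" "f A ** transpose A = mat 1" if "invertible A" for A
    using arg_cong[OF inv(1)[OF that], of transpose] arg_cong[OF inv(2)[OF that], of transpose]
    unfolding f_def by (simp_all only: matrix_transpose_mul transpose_mat)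
  have f_invertible: "invertible (f A)" if "invertible A" for A
    using f_inv[OF that] invertible_def by blast
  have ff: "f (f A) = A" if "invertible A" for A
  proof -
    have *: "transpose (f A) = inv\<^bsub>GL3_2\<^esub> A"
      by (simp add: f_def)
    have "f (f A) = (A ** transpose (f A)) ** f (f A)"
      by (simp only: * inv[OF that] matrix_mul_lid)
    also have "\<dots> = A"
      by (simp only: f_inv[OF f_invertible[OF that]] matrix_mul_rid flip: matrix_mul_assoc)
    finally show ?thesis .
  qed
  have f_mult: "f (A ** B) = f A ** f B" if "invertible A" "invertible B" for A B
    using GL.inv_mult_group[of A B] that
    by (simp add: f_def GL3_2_def matrix_transpose_mul)
  have f2: "f A \<in> carrier (form_group (0, 0, 0, 1, 1, 1))"
    if "A \<in> carrier (form_group (0, 0, 0, 0, 0, 0))" for A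
  proof -
    have A: "invertible A" "A *v ?u = ?u" using that unfolding mem2 by blast+
    have "transpose (f A) *v ?u = (inv\<^bsub>GL3_2\<^esub> A ** A) *v ?u"
      using A(2) by (simp add: f_def flip: matrix_vector_mul_assoc)
    then show ?thesis
      unfolding mem3 using inv(1)[OF A(1)] f_invertible[OF A(1)] by simp
  qed
  have f3: "f A \<in> carrier (form_group (0, 0, 0, 0, 0, 0))"
    if "A \<in> carrier (form_group (0, 0, 0, 1, 1, 1))" for A
  proof -
    have A: "invertible A" "transpose A *v ?u = ?u" using that unfolding mem3 by blast+
    have "f A *v ?u = (f A ** transpose A) *v ?u"
      using A(2) by (simp flip: matrix_vector_mul_assoc)
    then show ?thesis
      unfolding mem2 using f_inv(2)[OF A(1)] f_invertible[OF A(1)] by simp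
  qed
  have "f \<in> iso (form_group (0, 0, 0, 0, 0, 0)) (form_group (0, 0, 0, 1, 1, 1))"
    unfolding iso_def
  proof (intro CollectI conjI homI)
    show "bij_betw f (carrier (form_group (0, 0, 0, 0, 0, 0))) (carrier (form_group (0, 0, 0, 1, 1, 1)))"
    proof (rule bij_betwI[where g = f])
      fix A assume "A \<in> carrier (form_group (0, 0, 0, 0, 0, 0))"
      then show "f (f A) = A"
        using ff unfolding mem2 by blast
    next
      fix A assume "A \<in> carrier (form_group (0, 0, 0, 1, 1, 1))"
      then show "f (f A) = A"
        using ff unfolding mem3 by blast
    qed (use f2 f3 in blast)+
  next
    fix A B
    assume "A \<in> carrier (form_group (0, 0, 0, 0, 0, 0))" "B \<in> carrier (form_group (0, 0, 0, 0, 0, 0))"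
    then show "f (A \<otimes>\<^bsub>form_group (0, 0, 0, 0, 0, 0)\<^esub> B) = f A \<otimes>\<^bsub>form_group (0, 0, 0, 1, 1, 1)\<^esub> f B"
      unfolding mem2 form_group_simps(2) using f_mult by blast
  qed (rule f2)
  then show ?thesis
    using is_iso_def by blast
qed

text \<open>Serves to reverse the isomorphism out of \<open>dihedral_group 4\<close>, of which only
  closure under multiplication is checked.\<close>

lemma iso_set_sym_if_mult_closed:
  assumes h: "h \<in> iso G H"
    and closed: "\<And>x y. x \<in> carrier G \<Longrightarrow> y \<in> carrier G \<Longrightarrow> x \<otimes>\<^bsub>G\<^esub> y \<in> carrier G"
  shows "inv_into (carrier G) h \<in> iso H G"
proof -
  have bij: "bij_betw h (carrier G) (carrier H)"
    and hom: "\<And>x y. x \<in> carrier G \<Longrightarrow> y \<in> carrier G \<Longrightarrow> h (x \<otimes>\<^bsub>G\<^esub> y) = h x \<otimes>\<^bsub>H\<^esub> h y"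
    using h by (auto simp: iso_def hom_def)
  let ?g = "inv_into (carrier G) h"
  have g: "bij_betw ?g (carrier H) (carrier G)"
    using bij by (rule bij_betw_inv_into)
  have gx: "?g x \<in> carrier G" "h (?g x) = x" if "x \<in> carrier H" for x
    using that bij g by (auto simp: bij_betw_inv_into_right dest: bij_betwE)
  have "?g (x \<otimes>\<^bsub>H\<^esub> y) = ?g x \<otimes>\<^bsub>G\<^esub> ?g y" if "x \<in> carrier H" "y \<in> carrier H" for x y
  proof -
    have "h (?g x \<otimes>\<^bsub>G\<^esub> ?g y) = x \<otimes>\<^bsub>H\<^esub> y"
      using gx that by (simp add: hom)
    then show ?thesis
      using bij_betw_inv_into_left[OF bij closed[OF gx(1)[OF that(1)] gx(1)[OF that(2)]]] by simp
  qed
  then show ?thesis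
    using g gx by (auto simp: iso_def intro!: homI)
qed

text \<open>The form with vector \<open>110000\<close> has the nonzero zeros \<open>u = (1, 1, 0)\<close> and \<open>w = (0, 0, 1)\<close>.
  The matrix \<open>M a b e\<close> sends \<open>t = (1, 0, 0)\<close> to \<open>t + a u + b w\<close> and swaps \<open>u\<close> and \<open>w\<close> iff \<open>e = 1\<close>.\<close>

lemma form_group_110000: "form_group (1, 1, 0, 0, 0, 0) \<cong> dihedral_group 4"
proof -
  \<comment> \<open>The columns are the images of \<open>t\<close>, \<open>t + u\<close> and
    \<open>w\<close>.\<close>
  define M :: "bit \<Rightarrow> bit \<Rightarrow> bit \<Rightarrow> bit ^ 3 ^ 3" where
    "M a b e = of_columns (vector [1 + a, a, b]) (vector [a + e, 1 + a + e, b + e])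
       (vector [e, e, 1 + e])" for a b e
  \<comment> \<open>The matrices with \<open>e = 0\<close> form a Klein four-group; moving
    \<open>(a', b')\<close> past a factor with \<open>e = 1\<close> exchanges its entries.\<close>
  have M_mult: "M a b e ** M a' b' e' = M (a + a' * (1 + e) + b' * e) (b + a' * e + b' * (1 + e)) (e + e')"
    for a b e a' b' e'
    unfolding M_def mult_of_columns of_columns_mult_vec of_columns_eq_iff
    by (simp add: vec_eq_iff forall_3; cases a; cases b; cases e; cases a'; cases b'; cases e'; simp)
  have M_0: "M 0 0 0 = mat 1"
    by (rule sym) (simp add: M_def eq_of_columns_iff)
  have M_inj: "M a b e = M a' b' e' \<longleftrightarrow> a = a' \<and> b = b' \<and> e = e'" for a b e a' b' e'
    by (auto simp: M_def of_columns_eq_iff vector_3_eq_iff)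
  have M_form: "M a b e \<in> carrier (form_group (1, 1, 0, 0, 0, 0))" for a b e
  proof -
    have "M a b e ** M (a * (1 + e) + b * e) (a * e + b * (1 + e)) e = mat 1"
      "M (a * (1 + e) + b * e) (a * e + b * (1 + e)) e ** M a b e = mat 1"
      unfolding M_mult M_0[symmetric] M_inj by (cases a; cases b; cases e; simp)+
    then have "invertible (M a b e)"
      unfolding invertible_def by blast
    moreover have "cubic_form (1, 1, 0, 0, 0, 0) (M a b e *v x) = cubic_form (1, 1, 0, 0, 0, 0) x" for x
      unfolding M_def of_columns_mult_vec
      by (cases a; cases b; cases e; cases "x $ 1"; cases "x $ 2"; cases "x $ 3"; simp)
    ultimately show ?thesis by simp
  qed
  have form0: "w = vector [0, 0, 0] \<or> w = vector [0, 0, 1] \<or> w = vector [1, 1, 0]"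
    if "cubic_form (1, 1, 0, 0, 0, 0) w = 0" for w
  proof -
    have "\<forall>w. cubic_form (1, 1, 0, 0, 0, 0) w = 0 \<longrightarrow>
      w = vector [0, 0, 0] \<or> w = vector [0, 0, 1] \<or> w = vector [1, 1, 0]"
      unfolding forall_bit_vec3 all_bit_iff by (simp add: vector_3_eq_iff)
    then show ?thesis using that by blast
  qed
  have form1: "w = vector [1, 0, 0] \<or> w = vector [0, 1, 0] \<or> w = vector [1, 0, 1] \<or>
      w = vector [0, 1, 1] \<or> w = vector [1, 1, 1]"
    if "cubic_form (1, 1, 0, 0, 0, 0) w = 1" for w
  proof -
    have "\<forall>w. cubic_form (1, 1, 0, 0, 0, 0) w = 1 \<longrightarrow>
      w = vector [1, 0, 0] \<or> w = vector [0, 1, 0] \<or> w = vector [1, 0, 1] \<or>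
      w = vector [0, 1, 1] \<or> w = vector [1, 1, 1]"
      unfolding forall_bit_vec3 all_bit_iff by (simp add: vector_3_eq_iff)
    then show ?thesis using that by blast
  qed
  \<comment> \<open>The hypotheses prescribe the form on all seven nonzero combinations of the
    columns of a stabilizing matrix; a finite check leaves only the matrices
    \<open>M a b e\<close>.\<close>
  have triple: "\<exists>a b e. of_columns u v w = M a b e"
    if u: "cubic_form (1, 1, 0, 0, 0, 0) u = 1" and v: "cubic_form (1, 1, 0, 0, 0, 0) v = 1"
      and uv: "cubic_form (1, 1, 0, 0, 0, 0) (u + v) = 0"
      and w: "cubic_form (1, 1, 0, 0, 0, 0) w = 0"
      and uw: "cubic_form (1, 1, 0, 0, 0, 0) (u + w) = 1"
      and vw: "cubic_form (1, 1, 0, 0, 0, 0) (v + w) = 1"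
      and uvw: "cubic_form (1, 1, 0, 0, 0, 0) (u + v + w) = 1" for u v w
  proof -
    \<comment> \<open>The parameters appear as entries of the columns: \<open>a = u $ 2\<close>,
      \<open>b = u $ 3\<close> and \<open>e = w $ 1\<close>.\<close>
    have "u = vector [1 + u $ 2, u $ 2, u $ 3] \<and>
      v = vector [u $ 2 + w $ 1, 1 + u $ 2 + w $ 1, u $ 3 + w $ 1] \<and> w = vector [w $ 1, w $ 1, 1 + w $ 1]"
      using form1[OF u] form1[OF v] form0[OF w] uv uw vw uvw
      by (elim disjE; hypsubst; simp add: vector_3_eq_iff)
    then show ?thesis
      unfolding M_def of_columns_eq_iff by blast
  qed
  have surj: "\<exists>a b e. A = M a b e"
    if A: "A \<in> carrier (form_group (1, 1, 0, 0, 0, 0))" for A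
  proof -
    let ?q = "cubic_form (1, 1, 0, 0, 0, 0)"
    let ?x = "vector [1, 0, 0] :: bit ^ 3" and ?y = "vector [0, 1, 0] :: bit ^ 3"
      and ?z = "vector [0, 0, 1] :: bit ^ 3"
    have q: "?q (A *v v) = ?q v" for v
      using A unfolding form_group_simps by blast
    have "A = of_columns (A *v ?x) (A *v ?y) (A *v ?z)"
      by (simp add: eq_of_columns_iff)
    moreover have "\<exists>a b e. of_columns (A *v ?x) (A *v ?y) (A *v ?z) = M a b e"
      by (rule triple; unfold q matrix_vector_right_distrib[symmetric]; simp)
    ultimately show ?thesis by metis
  qed

  \<comment> \<open>Number the vectors \<open>t\<close>, \<open>t + u\<close>,
    \<open>t + u + w\<close>, \<open>t + w\<close> by 0, 1, 2, 3 as the vertices of a square. Then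
    \<open>\<rho> (i, s)\<close> sends vertex \<open>x\<close> to vertex \<open>i + x\<close> or
    \<open>i - x\<close>: vertex 0 goes to \<open>i\<close>, and the edge directions
    \<open>u\<close> and \<open>w\<close> are swapped iff \<open>odd i \<noteq> s\<close>.\<close>
  define \<rho> :: "int \<times> bool \<Rightarrow> bit ^ 3 ^ 3" where
    "\<rho> = (\<lambda>(i, s). M (of_bool (i = 1 \<or> i = 2)) (of_bool (i = 2 \<or> i = 3)) (of_bool (odd i \<noteq> s)))"
  have D: "carrier (dihedral_group 4) = {0, 1, 2, 3} \<times> UNIV"
    by (auto simp: dihedral_group_def)
  have "\<rho> \<in> iso (dihedral_group 4) (form_group (1, 1, 0, 0, 0, 0))"
    unfolding iso_def bij_betw_def
  proof (intro CollectI conjI homI)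
    fix x y assume "x \<in> carrier (dihedral_group 4)" "y \<in> carrier (dihedral_group 4)"
    then obtain i s j t where xy: "x = (i, s)" "y = (j, t)"
      and ij: "i = 0 \<or> i = 1 \<or> i = 2 \<or> i = 3" "j = 0 \<or> j = 1 \<or> j = 2 \<or> j = 3"
      unfolding D by blast
    show "\<rho> (x \<otimes>\<^bsub>dihedral_group 4\<^esub> y) = \<rho> x \<otimes>\<^bsub>form_group (1, 1, 0, 0, 0, 0)\<^esub> \<rho> y"
      unfolding form_group_simps(2) xy using ij
      by (elim disjE; hypsubst; cases s; cases t; simp add: dihedral_group_def \<rho>_def M_mult M_inj)
  next
    show "inj_on \<rho> (carrier (dihedral_group 4))"
      unfolding D inj_on_def by (auto simp: \<rho>_def M_inj)
    show "\<rho> ` carrier (dihedral_group 4) = carrier (form_group (1, 1, 0, 0, 0, 0))"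
    proof (intro equalityI subsetI)
      fix A assume "A \<in> carrier (form_group (1, 1, 0, 0, 0, 0))"
      then obtain a b e where A: "A = M a b e" using surj by blast
      have "\<exists>x\<in>carrier (dihedral_group 4). M a b e = \<rho> x"
        unfolding D by (cases a; cases b; cases e; simp add: \<rho>_def M_inj UNIV_bool)
      then show "A \<in> \<rho> ` carrier (dihedral_group 4)"
        unfolding A by blast
    qed (auto simp: \<rho>_def M_form simp del: form_group_simps(1))
  qed (auto simp: \<rho>_def M_form simp del: form_group_simps(1))
  moreover have "x \<otimes>\<^bsub>dihedral_group 4\<^esub> y \<in> carrier (dihedral_group 4)"
    if "x \<in> carrier (dihedral_group 4)" "y \<in> carrier (dihedral_group 4)" for x y
    using that by (auto simp: dihedral_group_def)
  ultimately show ?thesis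
    using iso_set_sym_if_mult_closed is_iso_def by blast
qed

section \<open>Automorphisms of extensions by cubic forms\<close>

text \<open>Since code loops need not be associative, the subgroup property of \<open>auto G\<close>
  in the group of bijections is derived from closure under multiplication alone.\<close>

lemma group_AutoGroup:
  assumes closed: "\<And>x y. x \<in> carrier G \<Longrightarrow> y \<in> carrier G \<Longrightarrow> x \<otimes>\<^bsub>G\<^esub> y \<in> carrier G"
  shows "group (AutoGroup G)"
proof -
  have "subgroup (auto G) (BijGroup (carrier G))"
  proof
    fix f g assume "f \<in> auto G" "g \<in> auto G"
    then have fg: "f \<in> hom G G" "g \<in> hom G G" "f \<in> Bij (carrier G)" "g \<in> Bij (carrier G)"
      by (auto simp: auto_def)
    then have "compose (carrier G) f g \<in> hom G G"
      using closed by (auto simp: hom_def compose_def Pi_iff)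
    then show "f \<otimes>\<^bsub>BijGroup (carrier G)\<^esub> g \<in> auto G"
      using fg by (simp add: auto_def BijGroup_def compose_Bij)
  next
    fix f assume "f \<in> auto G"
    then have f: "f \<in> hom G G" "f \<in> Bij (carrier G)"
      by (auto simp: auto_def)
    have "restrict (inv_into (carrier G) f) (carrier G) \<in> hom G G"
    proof (rule homI)
      fix x y assume xy: "x \<in> carrier G" "y \<in> carrier G"
      then show "restrict (inv_into (carrier G) f) (carrier G) (x \<otimes>\<^bsub>G\<^esub> y) =
        restrict (inv_into (carrier G) f) (carrier G) x \<otimes>\<^bsub>G\<^esub> restrict (inv_into (carrier G) f) (carrier G) y"
        using Bij_inv_into_lemma[of "carrier G" f "mult G" x y] f closed by (auto simp: hom_def)
    qed (use f in \<open>auto simp: Bij_inv_into_mem\<close>)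
    then show "inv\<^bsub>BijGroup (carrier G)\<^esub> f \<in> auto G"
      using f by (simp add: inv_BijGroup auto_def restrict_inv_into_Bij del: restrict_apply)
  qed (use closed in \<open>auto simp: auto_def BijGroup_def id_Bij hom_def\<close>)
  then show ?thesis
    unfolding AutoGroup_def by (rule subgroup.subgroup_is_group) (rule group_BijGroup)
qed

section \<open>Splitting of symmetric cocycles over the two-element field\<close>

lemma bit_add_left_cancel [simp]: "x + (x + y) = (y :: bit)"
  by (simp flip: add.assoc)

text \<open>The only multiples of \<open>a\<close> are 0 and \<open>a\<close>, so a new vector adds
  at most one coset to the span.\<close>

lemma span_insert_bit:
  "x \<in> vec.span (insert a S) \<longleftrightarrow> x \<in> vec.span S \<or> x + a \<in> vec.span S"
  for x a :: "bit ^ 'n"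
proof -
  have diff: "x - a = x + a"
    by (simp add: vec_eq_iff)
  have ex: "(\<exists>k::bit. P k) \<longleftrightarrow> P 0 \<or> P 1" for P
    by (metis bit_not_one_iff)
  show ?thesis
    by (simp only: vec.span_insert mem_Collect_eq ex vec.scale_zero_left vec.scale_one diff_0_right diff)
qed

text \<open>The only scalars are 0 and 1, so additivity implies linearity.\<close>

lemma bit_linearI:
  fixes g :: "bit ^ 'm \<Rightarrow> bit ^ 'n"
  assumes add: "\<And>x y. g (x + y) = g x + g y"
  shows "Vector_Spaces.linear (*s) (*s) g"
proof -
  have "g 0 = 0"
    using add[of 0 0] by simp
  then have "g (r *s x) = r *s g x" for r x
    by (cases r) simp_all
  with add show ?thesis
    by unfold_locales
qed

text \<open>An abelian extension of an elementary abelian 2-group by a group of order 2 whose elements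
  square to the identity is split.\<close>

lemma symmetric_cocycle_splits_on_span:
  fixes \<delta> :: "bit ^ 'n \<Rightarrow> bit ^ 'n \<Rightarrow> bit"
  assumes V: "vec.subspace V"
    and sym: "\<And>v w. v \<in> V \<Longrightarrow> w \<in> V \<Longrightarrow> \<delta> v w = \<delta> w v"
    and diag: "\<And>v. v \<in> V \<Longrightarrow> \<delta> v v = 0"
    and zero: "\<And>v. v \<in> V \<Longrightarrow> \<delta> 0 v = 0"
    and cocycle: "\<And>u v w. u \<in> V \<Longrightarrow> v \<in> V \<Longrightarrow> w \<in> V \<Longrightarrow>
      \<delta> (u + v) w = \<delta> u (v + w) + \<delta> u v + \<delta> v w"
    and S: "finite S" "S \<subseteq> V"
  shows "\<exists>s. \<forall>v\<in>vec.span S. \<forall>w\<in>vec.span S. s (v + w) = s v + s w + \<delta> v w"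
  using S
proof (induction S rule: finite_induct)
  case empty
  show ?case
    using zero[OF vec.subspace_0[OF V]] by (intro exI[of _ "\<lambda>_. 0"]) simp
next
  case (insert a S)
  let ?W = "vec.span S"
  obtain s where s: "\<And>v w. v \<in> ?W \<Longrightarrow> w \<in> ?W \<Longrightarrow> s (v + w) = s v + s w + \<delta> v w"
    using insert by auto
  have a: "a \<in> V" and WV: "v \<in> ?W \<Longrightarrow> v \<in> V" for v
    using insert.prems vec.span_minimal[OF _ V, of S] by auto
  note VI = a WV vec.subspace_add[OF V]
  show ?case
  proof (cases "a \<in> ?W")
    case True
    then show ?thesis
      using s by (auto simp: vec.span_redundant)
  next
    case False
    \<comment> \<open>Extend \<open>s\<close> to the coset of \<open>a\<close> by the value 0 at
      \<open>a\<close>; the splitting equation then forces the value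
      \<open>s w + \<delta> a w\<close> at \<open>a + w\<close>.\<close>
    define s' where "s' x = (if x \<in> ?W then s x else s (x + a) + \<delta> a (x + a))" for x
    have notW: "a + w \<notin> ?W" if "w \<in> ?W" for w
      using that False vec.span_add_eq2 by blast
    have s'_W: "s' w = s w" and s'_aW: "s' (a + w) = s w + \<delta> a w" if "w \<in> ?W" for w
      using that notW[OF that] by (simp_all add: s'_def add.commute[of a] add.assoc)
    have mixed: "s' (a + v + w) = s' (a + v) + s' w + \<delta> (a + v) w"
      if "v \<in> ?W" "w \<in> ?W" for v w
      using that by (simp add: add.assoc s'_aW s'_W vec.span_add s cocycle VI add_ac)
    \<comment> \<open>The cocycle identity for \<open>a, a, w\<close> together with the vanishing
      diagonal; it settles sums of two elements of the coset.\<close>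
    have \<delta>a: "\<delta> a (a + w) = \<delta> a w" if "w \<in> ?W" for w
    proof -
      have "\<delta> (a + a) w = \<delta> a (a + w) + \<delta> a a + \<delta> a w"
        using that by (intro cocycle VI)
      then show ?thesis
        using that by (simp add: zero diag VI) (metis bit_add_left_cancel add.commute add.right_neutral)
    qed
    have both: "s' (a + v + (a + w)) = s' (a + v) + s' (a + w) + \<delta> (a + v) (a + w)"
      if vw: "v \<in> ?W" "w \<in> ?W" for v w
    proof -
      have "\<delta> (a + v) (a + w) = \<delta> (v + a) (a + w)"
        by (simp add: add.commute)
      also have "\<dots> = \<delta> v (a + (a + w)) + \<delta> v a + \<delta> a (a + w)"
        using vw by (intro cocycle VI)
      also have "\<dots> = \<delta> v w + \<delta> a v + \<delta> a w"
        using vw by (simp add: \<delta>a sym[of v a] VI)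
      finally show ?thesis
        using vw by (simp add: s'_aW s'_W s vec.span_add add_ac)
    qed
    have cases: "P x" if "x \<in> vec.span (insert a S)" "\<And>w. w \<in> ?W \<Longrightarrow> P w"
      "\<And>w. w \<in> ?W \<Longrightarrow> P (a + w)" for P x
      using that(1) that(2)[of x] that(3)[of "x + a"] unfolding span_insert_bit
      by (auto simp: add.commute)
    have "\<forall>w\<in>vec.span (insert a S). s' (v + w) = s' v + s' w + \<delta> v w"
      if "v \<in> vec.span (insert a S)" for v
      using that
    proof (rule cases; intro ballI)
      fix v w assume v: "v \<in> ?W" and w: "w \<in> vec.span (insert a S)"
      from w show "s' (v + w) = s' v + s' w + \<delta> v w"
      proof (rule cases)
        fix w assume w: "w \<in> ?W"
        then show "s' (v + w) = s' v + s' w + \<delta> v w"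
          using v by (simp add: s'_W s vec.span_add)
        show "s' (v + (a + w)) = s' v + s' (a + w) + \<delta> v (a + w)"
          using mixed[OF w v] sym[of v "a + w"] v w by (simp add: VI add_ac)
      qed
    next
      fix v w assume v: "v \<in> ?W" and w: "w \<in> vec.span (insert a S)"
      from w show "s' (a + v + w) = s' (a + v) + s' w + \<delta> (a + v) w"
        by (rule cases) (use mixed both v in blast)+
    qed
    then show ?thesis
      by blast
  qed
qed

text \<open>Code loops in additive notation: \<open>el e v\<close> stands for (-1)^e times the lift
  of \<open>v\<close>, \<open>\<psi>\<close> is the exponent of the factor set,
  \<open>q (v + w) + q v + q w\<close> that of the commutator and \<open>\<tau>\<close> that of the
  associator. Additivity of \<open>\<tau>\<close> is stated in the first argument; its symmetry
  follows from \<open>q_polar\<close>.\<close>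

locale cubic_extension =
  fixes V :: "(bit ^ 'm) set" and q :: "bit ^ 'm \<Rightarrow> bit"
    and \<tau> :: "bit ^ 'm \<Rightarrow> bit ^ 'm \<Rightarrow> bit ^ 'm \<Rightarrow> bit"
    and \<psi> :: "bit ^ 'm \<Rightarrow> bit ^ 'm \<Rightarrow> bit"
    and L :: "('a, 'b) monoid_scheme" (structure) and el :: "bit \<Rightarrow> bit ^ 'm \<Rightarrow> 'a"
  assumes subspace: "vec.subspace V"
    and \<tau>_add: "\<lbrakk>u \<in> V; v \<in> V; w \<in> V; x \<in> V\<rbrakk> \<Longrightarrow> \<tau> (u + x) v w = \<tau> u v w + \<tau> x v w"
    and q_polar: "\<lbrakk>u \<in> V; v \<in> V; w \<in> V\<rbrakk> \<Longrightarrow>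
      q (u + v + w) = q (u + v) + q (u + w) + q (v + w) + q u + q v + q w + \<tau> u v w"
    and \<psi>_diag: "v \<in> V \<Longrightarrow> \<psi> v v = q v"
    and \<psi>_commute: "\<lbrakk>v \<in> V; w \<in> V\<rbrakk> \<Longrightarrow> \<psi> v w = \<psi> w v + (q (v + w) + q v + q w)"
    and \<psi>_0: "v \<in> V \<Longrightarrow> \<psi> 0 v = 0" "v \<in> V \<Longrightarrow> \<psi> v 0 = 0"
    and \<psi>_cocycle: "\<lbrakk>u \<in> V; v \<in> V; w \<in> V\<rbrakk> \<Longrightarrow>
      \<psi> (u + v) w = \<psi> u (v + w) + \<psi> u v + \<psi> v w + \<tau> u v w"
    and el_bij: "bij_betw (\<lambda>(e, v). el e v) (UNIV \<times> V) (carrier L)"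
    and el_mult: "\<lbrakk>v \<in> V; w \<in> V\<rbrakk> \<Longrightarrow> el e v \<otimes> el d w = el (e + d + \<psi> v w) (v + w)"
    and el_one: "el 0 0 = \<one>"
begin

lemma V_0 [simp]: "0 \<in> V"
  and V_add [simp]: "u \<in> V \<Longrightarrow> v \<in> V \<Longrightarrow> u + v \<in> V"
  using vec.subspace_0 vec.subspace_add subspace by blast+

declare \<psi>_diag [simp] \<psi>_0 [simp] el_mult [simp]

lemma q_0 [simp]: "q 0 = 0"
  by (metis V_0 \<psi>_0(1) \<psi>_diag)

lemma el_carrier [simp]: "v \<in> V \<Longrightarrow> el e v \<in> carrier L"
  using bij_betwE[OF el_bij] by auto

lemma el_eq_iff [simp]: "v \<in> V \<Longrightarrow> w \<in> V \<Longrightarrow> el e v = el d w \<longleftrightarrow> e = d \<and> v = w"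
  using inj_on_eq_iff[OF bij_betw_imp_inj_on[OF el_bij], of "(e, v)" "(d, w)"] by auto

lemma el_cases: assumes "x \<in> carrier L" obtains e v where "v \<in> V" "x = el e v"
  using assms bij_betw_imp_surj_on[OF el_bij] by force

lemma mult_closed: "x \<in> carrier L \<Longrightarrow> y \<in> carrier L \<Longrightarrow> x \<otimes> y \<in> carrier L"
  by (elim el_cases) simp

lemma inv_el [simp]: assumes v: "v \<in> V" shows "inv (el e v) = el (e + q v) v"
  unfolding m_inv_def
proof (rule the_equality)
  fix y assume y: "y \<in> carrier L \<and> el e v \<otimes> y = \<one> \<and> y \<otimes> el e v = \<one>"
  then obtain d w where w: "w \<in> V" "y = el d w" by (auto elim: el_cases)
  with y v have *: "e + d + \<psi> v w = 0" "v + w = 0"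
    by (simp_all flip: el_one)
  then have "w = v"
    by (simp add: bit_vec_add_eq_0_iff)
  then show "y = el (e + q v) v"
    using * v w by simp (metis bit_add_left_cancel add.assoc add.commute add.right_neutral)
qed (use v in \<open>simp_all flip: el_one add: add_ac\<close>)

text \<open>All other terms of \<open>q_polar\<close> are symmetric in the three vectors, and for
  \<open>v = w\<close> they cancel.\<close>

lemma \<tau>_swap: "\<lbrakk>u \<in> V; v \<in> V; w \<in> V\<rbrakk> \<Longrightarrow> \<tau> u v w = \<tau> v u w"
  "\<lbrakk>u \<in> V; v \<in> V; w \<in> V\<rbrakk> \<Longrightarrow> \<tau> u v w = \<tau> u w v"
  and \<tau>_self: "\<lbrakk>u \<in> V; v \<in> V\<rbrakk> \<Longrightarrow> \<tau> u v v = 0"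
proof -
  show "\<tau> u v w = \<tau> v u w" if "u \<in> V" "v \<in> V" "w \<in> V"
    using q_polar[of u v w] q_polar[of v u w] that by (simp add: add_ac)
  show "\<tau> u v w = \<tau> u w v" if "u \<in> V" "v \<in> V" "w \<in> V"
    using q_polar[of u v w] q_polar[of u w v] that by (simp add: add_ac)
  show "\<tau> u v v = 0" if "u \<in> V" "v \<in> V"
    using q_polar[of u v v] that by (simp add: add.assoc)
qed

lemma commutator_el:
  assumes v: "v \<in> V" and w: "w \<in> V"
  shows "commutator L (el e v) (el d w) = el (q (v + w) + q v + q w) 0"
proof -
  have "v + w + v = w"
    by (simp add: add.commute[of v] add.assoc)
  moreover have "\<psi> (v + w) v = \<psi> w v + q v"
    using \<psi>_cocycle[of w v v] v w by (simp add: add.commute \<tau>_self)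
  ultimately show ?thesis
    using v w unfolding commutator_def
    by (simp add: add_ac \<psi>_commute[of v w])
qed

lemma associator_el:
  assumes "u \<in> V" "v \<in> V" "w \<in> V"
  shows "(el e u \<otimes> el d v) \<otimes> el c w = el (\<tau> u v w) 0 \<otimes> (el e u \<otimes> (el d v \<otimes> el c w))"
  using assms by (simp add: \<psi>_cocycle add_ac)

lemma nonassociative_iff: "nonassociative L \<longleftrightarrow> (\<exists>u\<in>V. \<exists>v\<in>V. \<exists>w\<in>V. \<tau> u v w = 1)"
proof
  assume "nonassociative L"
  then obtain x y z where "x \<in> carrier L" "y \<in> carrier L" "z \<in> carrier L" "(x \<otimes> y) \<otimes> z \<noteq> x \<otimes> (y \<otimes> z)"
    unfolding nonassociative_def by blast
  moreover from this obtain e u d v c w where "u \<in> V" "v \<in> V" "w \<in> V" "x = el e u" "y = el d v" "z = el c w"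
    by (elim el_cases)
  ultimately show "\<exists>u\<in>V. \<exists>v\<in>V. \<exists>w\<in>V. \<tau> u v w = 1"
    by (intro bexI[of _ u] bexI[of _ v] bexI[of _ w]) (auto simp: \<psi>_cocycle add_ac)
next
  assume "\<exists>u\<in>V. \<exists>v\<in>V. \<exists>w\<in>V. \<tau> u v w = 1"
  then obtain u v w where "u \<in> V" "v \<in> V" "w \<in> V" "\<tau> u v w = 1" by blast
  then have "(el 0 u \<otimes> el 0 v) \<otimes> el 0 w \<noteq> el 0 u \<otimes> (el 0 v \<otimes> el 0 w)"
    by (simp add: \<psi>_cocycle add_ac)
  then show "nonassociative L"
    unfolding nonassociative_def using \<open>u \<in> V\<close> \<open>v \<in> V\<close> \<open>w \<in> V\<close> el_carrier by blast
qed

section \<open>The action of loop automorphisms on \<open>V\<close>\<close>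

lemma auto_hom:
  assumes "f \<in> auto L" "x \<in> carrier L" "y \<in> carrier L"
  shows "f (x \<otimes> y) = f x \<otimes> f y"
  using assms by (simp add: auto_def hom_mult)

lemma auto_carrier: "f \<in> auto L \<Longrightarrow> x \<in> carrier L \<Longrightarrow> f x \<in> carrier L"
  by (auto simp: auto_def hom_def)

lemma auto_inj: "f \<in> auto L \<Longrightarrow> x \<in> carrier L \<Longrightarrow> y \<in> carrier L \<Longrightarrow> f x = f y \<longleftrightarrow> x = y"
  by (auto simp: auto_def Bij_def bij_betw_def inj_on_eq_iff)

text \<open>Membership in \<open>auto\<close> asserts multiplicativity only; the unit is preserved
  because it is the only idempotent.\<close>

lemma auto_one:
  assumes f: "f \<in> auto L"
  shows "f (el 0 0) = el 0 0"
proof -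
  obtain e v where v: "v \<in> V" "f (el 0 0) = el e v"
    using auto_carrier[OF f, of "el 0 0"] by (auto elim: el_cases)
  have "f (el 0 0) \<otimes> f (el 0 0) = f (el 0 0)"
    by (subst auto_hom[OF f, symmetric]) simp_all
  with v show ?thesis
    by auto
qed

text \<open>The element \<open>-1\<close> is the only nontrivial associator.\<close>

lemma auto_minus_one:
  assumes f: "f \<in> auto L" and "nonassociative L"
  shows "f (el 1 0) = el 1 0"
proof -
  obtain u v w where uvw: "u \<in> V" "v \<in> V" "w \<in> V" "\<tau> u v w = 1"
    using assms nonassociative_iff by blast
  obtain e x where x: "x \<in> V" "f (el 0 u) = el e x"
    using auto_carrier[OF f, of "el 0 u"] uvw by (auto elim: el_cases)
  obtain d y where y: "y \<in> V" "f (el 0 v) = el d y"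
    using auto_carrier[OF f, of "el 0 v"] uvw by (auto elim: el_cases)
  obtain c z where z: "z \<in> V" "f (el 0 w) = el c z"
    using auto_carrier[OF f, of "el 0 w"] uvw by (auto elim: el_cases)
  obtain b t where t: "t \<in> V" "f (el 1 0) = el b t"
    using auto_carrier[OF f, of "el 1 0"] by (auto elim: el_cases)
  have "(f (el 0 u) \<otimes> f (el 0 v)) \<otimes> f (el 0 w) = f ((el 0 u \<otimes> el 0 v) \<otimes> el 0 w)"
    using uvw by (simp add: auto_hom[OF f] mult_closed del: el_mult)
  also have "\<dots> = f (el 1 0 \<otimes> (el 0 u \<otimes> (el 0 v \<otimes> el 0 w)))"
    using associator_el[of u v w 0 0 0] uvw by (simp del: el_mult)
  also have "\<dots> = f (el 1 0) \<otimes> (f (el 0 u) \<otimes> (f (el 0 v) \<otimes> f (el 0 w)))"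
    using uvw by (simp add: auto_hom[OF f] mult_closed del: el_mult)
  \<comment> \<open>Both sides have the same component in \<open>V\<close> except for the summand
    \<open>t\<close>. So the image of -1 is 1 or -1, and injectivity excludes 1.\<close>
  finally have "t = 0"
    unfolding x(2) y(2) z(2) t(2) using x(1) y(1) z(1) t(1)
    by (simp add: add.assoc)
  moreover have "f (el 1 0) \<noteq> f (el 0 0)"
    using auto_inj[OF f, of "el 1 0" "el 0 0"] by simp
  ultimately show ?thesis
    using t auto_one[OF f] by simp
qed

text \<open>Only the lifts \<open>el 0 v\<close> are consulted; that \<open>el 1 v\<close> gives the
  same vector rests on -1 being fixed and is part of \<open>auto_el\<close>.\<close>

definition induced :: "('a \<Rightarrow> 'a) \<Rightarrow> bit ^ 'm \<Rightarrow> bit ^ 'm" where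
  "induced f v = (THE w. w \<in> V \<and> (\<exists>e. f (el 0 v) = el e w))"

lemma auto_el_0:
  assumes "f \<in> auto L" "v \<in> V"
  shows "induced f v \<in> V" "\<exists>e. f (el 0 v) = el e (induced f v)"
proof -
  obtain e w where w: "w \<in> V" "f (el 0 v) = el e w"
    using auto_carrier[of f "el 0 v"] assms by (auto elim: el_cases)
  then have "induced f v = w"
    unfolding induced_def by (intro the_equality) auto
  with w show "induced f v \<in> V" "\<exists>e. f (el 0 v) = el e (induced f v)" by auto
qed

lemma induced_eqI:
  assumes "w \<in> V" "f (el 0 v) = el e w"
  shows "induced f v = w"
  unfolding induced_def using assms by (intro the_equality) auto

context
  assumes nonassoc: "nonassociative L"
begin

lemma auto_el:
  assumes f: "f \<in> auto L"
  obtains s where "\<And>e v. v \<in> V \<Longrightarrow> f (el e v) = el (e + s v) (induced f v)"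
proof -
  obtain s where s: "f (el 0 v) = el (s v) (induced f v)" if "v \<in> V" for v
    using auto_el_0[OF f] by metis
  have "f (el e v) = el (e + s v) (induced f v)" if v: "v \<in> V" for e v
  proof -
    have "f (el e 0) = el e 0"
      using auto_one[OF f] auto_minus_one[OF f nonassoc] by (cases e) simp_all
    then have "f (el e 0 \<otimes> el 0 v) = el e 0 \<otimes> el (s v) (induced f v)"
      using v by (simp add: auto_hom[OF f] s del: el_mult)
    then show ?thesis
      using v auto_el_0(1)[OF f v] by simp
  qed
  then show ?thesis by (rule that)
qed

lemma induced_add:
  assumes f: "f \<in> auto L" and v: "v \<in> V" and w: "w \<in> V"
  shows "induced f (v + w) = induced f v + induced f w"
proof -
  obtain s where s: "\<And>e v. v \<in> V \<Longrightarrow> f (el e v) = el (e + s v) (induced f v)"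
    using auto_el[OF f] by blast
  have "f (el 0 v \<otimes> el 0 w) = f (el 0 v) \<otimes> f (el 0 w)"
    using v w by (simp add: auto_hom[OF f] del: el_mult)
  then show ?thesis
    using v w by (simp add: s auto_el_0(1)[OF f])
qed

text \<open>The square of a lift of \<open>v\<close> is \<open>el (q v) 0\<close>, and
  \<open>f\<close> fixes both signs.\<close>

lemma induced_form:
  assumes f: "f \<in> auto L" and v: "v \<in> V"
  shows "q (induced f v) = q v"
proof -
  obtain s where s: "\<And>e v. v \<in> V \<Longrightarrow> f (el e v) = el (e + s v) (induced f v)"
    using auto_el[OF f] by blast
  note [simp] = auto_el_0(1)[OF f]
  have "f (el 0 v \<otimes> el 0 v) = f (el 0 v) \<otimes> f (el 0 v)"
    using v by (simp add: auto_hom[OF f] del: el_mult)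
  moreover have "s 0 = 0"
    using auto_one[OF f] by (simp add: s)
  ultimately show ?thesis
    using v by (simp add: s)
qed

lemma induced_compose:
  assumes f: "f \<in> auto L" and g: "g \<in> auto L" and v: "v \<in> V"
  shows "induced (compose (carrier L) f g) v = induced f (induced g v)"
proof -
  obtain s where s: "\<And>e v. v \<in> V \<Longrightarrow> f (el e v) = el (e + s v) (induced f v)"
    using auto_el[OF f] by blast
  obtain e where "g (el 0 v) = el e (induced g v)"
    using auto_el_0[OF g v] by blast
  then show ?thesis
    using v s auto_el_0(1)[OF g v] auto_el_0(1)[OF f] by (intro induced_eqI) (simp_all add: compose_def)
qed

text \<open>Identifies the subgroup divided out in \<open>Out\<close> as the kernel of the action on
  \<open>V\<close>.\<close>

lemma sign_automorphisms_eq: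
  "sign_automorphisms L (el 1 0) = {f \<in> auto L. \<forall>v\<in>V. induced f v = v}"
proof -
  have "(\<forall>x\<in>carrier L. f x = x \<or> f x = el 1 0 \<otimes> x) \<longleftrightarrow> (\<forall>v\<in>V. induced f v = v)" if f: "f \<in> auto L" for f
  proof -
    obtain s where s: "\<And>e v. v \<in> V \<Longrightarrow> f (el e v) = el (e + s v) (induced f v)"
      using auto_el[OF f] by blast
    show ?thesis
    proof (intro iffI ballI)
      fix v assume "\<forall>x\<in>carrier L. f x = x \<or> f x = el 1 0 \<otimes> x" and v: "v \<in> V"
      then have "f (el 0 v) = el 0 v \<or> f (el 0 v) = el 1 0 \<otimes> el 0 v"
        using el_carrier by blast
      then show "induced f v = v"
        using v auto_el_0(1)[OF f v] by (auto simp: s)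
    next
      fix x assume "\<forall>v\<in>V. induced f v = v" "x \<in> carrier L"
      then obtain e v where "x = el e v" "v \<in> V" "induced f v = v"
        by (auto elim: el_cases)
      then show "f x = x \<or> f x = el 1 0 \<otimes> x"
        by (cases "s v") (auto simp: s add.commute)
    qed
  qed
  then show ?thesis
    unfolding sign_automorphisms_def by blast
qed

end

text \<open>The lift has the form \<open>el e v \<mapsto> el (e + s v) (g v)\<close>. It is
  multiplicative exactly when \<open>s\<close> splits the difference between \<open>\<psi>\<close>
  and its pullback along \<open>g\<close>.\<close>

lemma ex_auto_inducing:
  assumes fin: "finite S" "V = vec.span S"
    and g_bij: "bij_betw g V V"
    and g_add: "\<And>v w. v \<in> V \<Longrightarrow> w \<in> V \<Longrightarrow> g (v + w) = g v + g w"
    and g_form: "\<And>v. v \<in> V \<Longrightarrow> q (g v) = q v"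
  shows "\<exists>f\<in>auto L. \<forall>v\<in>V. induced f v = g v"
proof -
  have g [simp]: "g v \<in> V" if "v \<in> V" for v
    using that g_bij bij_betwE by blast
  have g_0: "g 0 = 0"
    using g_add[of 0 0] by simp
  \<comment> \<open>By \<open>q_polar\<close> the form \<open>q\<close> determines
    \<open>\<tau>\<close>. Hence the associator terms cancel in \<open>\<delta>\<close>, which
    becomes a genuine cocycle.\<close>
  have \<tau>_g: "\<tau> (g u) (g v) (g w) = \<tau> u v w" if "u \<in> V" "v \<in> V" "w \<in> V" for u v w
    using q_polar[of u v w] q_polar[of "g u" "g v" "g w"] that
    by (simp add: g_form flip: g_add)
  define \<delta> where "\<delta> v w = \<psi> (g v) (g w) + \<psi> v w" for v w
  have "\<exists>s. \<forall>v\<in>vec.span S. \<forall>w\<in>vec.span S. s (v + w) = s v + s w + \<delta> v w"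
  proof (rule symmetric_cocycle_splits_on_span[OF subspace _ _ _ _ fin(1)])
    show "S \<subseteq> V"
      using vec.span_superset fin(2) by blast
    show "\<delta> v w = \<delta> w v" if "v \<in> V" "w \<in> V" for v w
      using that \<psi>_commute[of v w] \<psi>_commute[of "g v" "g w"]
      by (simp add: \<delta>_def g_form add_ac flip: g_add)
    show "\<delta> (u + v) w = \<delta> u (v + w) + \<delta> u v + \<delta> v w" if "u \<in> V" "v \<in> V" "w \<in> V" for u v w
      using that by (simp add: \<delta>_def g_add \<psi>_cocycle \<tau>_g add_ac)
  qed (simp_all add: \<delta>_def g_form g_0)
  then obtain s where s: "\<And>v w. v \<in> V \<Longrightarrow> w \<in> V \<Longrightarrow> s (v + w) = s v + s w + \<delta> v w"
    using fin(2) by blast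
  define el' where "el' = inv_into (UNIV \<times> V) (\<lambda>(e, v). el e v)"
  \<comment> \<open>Restriction to the carrier makes \<open>f\<close> extensional, as
    \<open>Bij\<close> requires.\<close>
  define f where "f = (\<lambda>x\<in>carrier L. case el' x of (e, v) \<Rightarrow> el (e + s v) (g v))"
  have f_el: "f (el e v) = el (e + s v) (g v)" if "v \<in> V" for e v
  proof -
    have "el' (el e v) = (e, v)"
      using bij_betw_inv_into_left[OF el_bij, of "(e, v)"] that by (simp add: el'_def)
    then show ?thesis
      using that by (simp add: f_def)
  qed
  have "f \<in> hom L L"
  proof (rule homI)
    fix x y assume "x \<in> carrier L" "y \<in> carrier L"
    then show "f (x \<otimes> y) = f x \<otimes> f y"
      by (elim el_cases) (simp add: f_el g_add s \<delta>_def add_ac)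
  qed (auto elim!: el_cases simp: f_el)
  moreover have "bij_betw f (carrier L) (carrier L)"
    unfolding bij_betw_def
  proof
    show "inj_on f (carrier L)"
      using bij_betw_imp_inj_on[OF g_bij]
      by (intro inj_onI) (auto elim!: el_cases simp: f_el inj_on_eq_iff)
    show "f ` carrier L = carrier L"
    proof (intro equalityI subsetI)
      fix x assume "x \<in> carrier L"
      then obtain e w where w: "w \<in> V" "x = el e w"
        by (rule el_cases)
      then obtain v where "v \<in> V" "w = g v"
        using bij_betw_imp_surj_on[OF g_bij] by (metis imageE)
      with w have "x = f (el (e + s v) v)"
        by (simp add: f_el add.assoc)
      then show "x \<in> f ` carrier L"
        using \<open>v \<in> V\<close> by simp
    qed (auto elim!: el_cases simp: f_el)
  qed
  ultimately have "f \<in> auto L"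
    by (simp add: auto_def Bij_def f_def)
  moreover have "\<forall>v\<in>V. induced f v = g v"
    using f_el by (auto intro: induced_eqI)
  ultimately show ?thesis by blast
qed

text \<open>The first isomorphism theorem for the action of \<open>auto L\<close> on
  \<open>V\<close>, written as matrices in the coordinates \<open>B\<close>.\<close>

theorem Out_iso_form_group:
  assumes nonassoc: "nonassociative L"
    and B_linear: "Vector_Spaces.linear (*s) (*s) B" and B_bij: "bij_betw B (UNIV :: (bit ^ 3) set) V"
    and q_B: "\<And>x. q (B x) = cubic_form l x"
  shows "Out L (el 1 0) \<cong> form_group l"
proof -
  define C where "C = inv_into UNIV B"
  have B [simp]: "B x \<in> V" and CB [simp]: "C (B x) = x" for x
    using bij_betwE[OF B_bij] bij_betw_inv_into_left[OF B_bij] by (auto simp: C_def)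
  have BC [simp]: "B (C v) = v" if "v \<in> V" for v
    using bij_betw_inv_into_right[OF B_bij that] by (simp add: C_def)
  have B_add: "B (x + y) = B x + B y" for x y
    using B_linear by (rule vec.linear_add)
  have C_add: "C (v + w) = C v + C w" if "v \<in> V" "w \<in> V" for v w
    using that CB[of "C v + C w"] by (simp add: B_add)
  note ind [simp] = auto_el_0(1)
  note ind_add = induced_add[OF nonassoc]
  note ind_form = induced_form[OF nonassoc]
  define mat_of where "mat_of f = matrix (\<lambda>x. C (induced f (B x)))" for f
  have mat_of: "mat_of f *v x = C (induced f (B x))" if f: "f \<in> auto L" for f x
    unfolding mat_of_def
    by (intro matrix_works bit_linearI) (simp add: f B_add ind_add C_add)
  have mat_of_compose: "mat_of (compose (carrier L) f g) = mat_of f ** mat_of g"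
    if "f \<in> auto L" "g \<in> auto L" "compose (carrier L) f g \<in> auto L" for f g
    unfolding matrix_eq using that
    by (simp add: mat_of induced_compose[OF nonassoc] flip: matrix_vector_mul_assoc)

  interpret Aut: group "AutoGroup L"
    using mult_closed by (rule group_AutoGroup)
  have Aut: "carrier (AutoGroup L) = auto L"
    "f \<in> auto L \<Longrightarrow> g \<in> auto L \<Longrightarrow> f \<otimes>\<^bsub>AutoGroup L\<^esub> g = compose (carrier L) f g" for f g
    by (auto simp: AutoGroup_def BijGroup_def auto_def)
  have mat_of_mult: "mat_of (f \<otimes>\<^bsub>AutoGroup L\<^esub> g) = mat_of f ** mat_of g"
    if "f \<in> auto L" "g \<in> auto L" for f g
    using that mat_of_compose Aut.m_closed[of f g] by (simp add: Aut)
  have mat_of_eq_1_iff: "mat_of f = mat 1 \<longleftrightarrow> (\<forall>v\<in>V. induced f v = v)" if f: "f \<in> auto L" for f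
  proof
    assume *: "mat_of f = mat 1"
    show "\<forall>v\<in>V. induced f v = v"
    proof
      fix v assume v: "v \<in> V"
      have "C (induced f v) = C v"
        using mat_of[OF f, of "C v"] v * by simp
      then show "induced f v = v"
        using v f by (metis BC ind)
    qed
  qed (simp add: matrix_eq mat_of f)
  have one: "mat_of \<one>\<^bsub>AutoGroup L\<^esub> = mat 1"
  proof -
    have "\<one>\<^bsub>AutoGroup L\<^esub> \<in> auto L"
      using Aut.one_closed by (simp add: Aut)
    moreover have "induced \<one>\<^bsub>AutoGroup L\<^esub> v = v" if "v \<in> V" for v
      using that by (intro induced_eqI) (auto simp: AutoGroup_def BijGroup_def)
    ultimately show ?thesis
      using mat_of_eq_1_iff by blast
  qed
  have mat_of_carrier: "mat_of f \<in> carrier (form_group l)" if f: "f \<in> auto L" for f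
  proof -
    have inv: "inv\<^bsub>AutoGroup L\<^esub> f \<in> auto L"
      using Aut.inv_closed[of f] f by (simp add: Aut)
    have "mat_of f ** mat_of (inv\<^bsub>AutoGroup L\<^esub> f) = mat 1"
      "mat_of (inv\<^bsub>AutoGroup L\<^esub> f) ** mat_of f = mat 1"
      using f inv Aut.l_inv[of f] Aut.r_inv[of f] by (simp_all add: Aut(1) one flip: mat_of_mult)
    then have "invertible (mat_of f)"
      unfolding invertible_def by blast
    moreover have "cubic_form l (mat_of f *v x) = cubic_form l x" for x
      using f by (simp add: mat_of ind_form flip: q_B)
    ultimately show ?thesis by simp
  qed
  have surj: "\<exists>f\<in>auto L. A = mat_of f" if A: "A \<in> carrier (form_group l)" for A
  proof -
    obtain A' where A': "A ** A' = mat 1" "A' ** A = mat 1"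
      using A by (auto simp: invertible_def)
    define g where "g v = B (A *v C v)" for v
    let ?S = "B ` {vector [1, 0, 0], vector [0, 1, 0], vector [0, 0, 1]}"
    \<comment> \<open>The lifting lemma works on a finite spanning set; the images of the unit
      vectors provide one.\<close>
    have span: "V = vec.span ?S"
    proof
      show "vec.span ?S \<subseteq> V"
        by (rule vec.span_minimal[OF _ subspace]) auto
      have "B x \<in> vec.span ?S" for x
      proof -
        have "x = x $ 1 *s vector [1, 0, 0] + x $ 2 *s vector [0, 1, 0] + x $ 3 *s vector [0, 0, 1]"
          by (simp add: vec_eq_iff forall_3)
        then have "B x = x $ 1 *s B (vector [1, 0, 0]) + x $ 2 *s B (vector [0, 1, 0]) +
            x $ 3 *s B (vector [0, 0, 1])"
          by (metis vec.linear_add[OF B_linear] vec.linear_scale[OF B_linear])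
        also have "\<dots> \<in> vec.span ?S"
          by (intro vec.span_add vec.span_scale vec.span_base) auto
        finally show ?thesis .
      qed
      then show "V \<subseteq> vec.span ?S"
        using bij_betw_imp_surj_on[OF B_bij] by blast
    qed
    have "\<exists>f\<in>auto L. \<forall>v\<in>V. induced f v = g v"
    proof (rule ex_auto_inducing[OF _ span])
      show "bij_betw g V V"
      proof (rule bij_betwI[where g = "\<lambda>v. B (A' *v C v)"])
      qed (auto simp: g_def matrix_vector_mul_assoc A')
      show "g (v + w) = g v + g w" if "v \<in> V" "w \<in> V" for v w
        using that by (simp add: g_def C_add B_add matrix_vector_right_distrib)
      show "q (g v) = q v" if "v \<in> V" for v
        using A that q_B[of "C v"] by (simp add: g_def q_B)
    qed simp
    then obtain f where f: "f \<in> auto L" "\<And>v. v \<in> V \<Longrightarrow> induced f v = g v" by blast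
    then have "A = mat_of f"
      by (simp add: matrix_eq mat_of g_def)
    with f show ?thesis by blast
  qed

  interpret group_hom "AutoGroup L" "form_group l" mat_of
  proof (intro group_hom.intro group_hom_axioms.intro homI)
    show "mat_of (f \<otimes>\<^bsub>AutoGroup L\<^esub> g) = mat_of f \<otimes>\<^bsub>form_group l\<^esub> mat_of g"
      if "f \<in> carrier (AutoGroup L)" "g \<in> carrier (AutoGroup L)" for f g
      using that unfolding Aut form_group_simps by (rule mat_of_mult)
  qed (use mat_of_carrier Aut group_form_group Aut.is_group in \<open>auto simp del: form_group_simps(1)\<close>)
  have "kernel (AutoGroup L) (form_group l) mat_of = sign_automorphisms L (el 1 0)"
    unfolding kernel_def sign_automorphisms_eq[OF nonassoc] Aut(1) form_group_simps
    using mat_of_eq_1_iff by blast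
  moreover have "mat_of ` carrier (AutoGroup L) = carrier (form_group l)"
    unfolding Aut(1) using mat_of_carrier surj by blast
  ultimately show ?thesis
    unfolding Out_def using FactGroup_iso by simp
qed

end

section \<open>Code loops of rank 3\<close>

definition bit_sign :: "bit \<Rightarrow> int" where
  "bit_sign e = (if e = 1 then -1 else 1)"

lemma bit_sign_simps [simp]: "bit_sign 0 = 1" "bit_sign 1 = -1" "bit_sign (a + b) = bit_sign a * bit_sign b"
  "bit_sign a = bit_sign b \<longleftrightarrow> a = b"
  by (cases a; cases b; simp add: bit_sign_def)+

lemma bit_sign_of_nat: "bit_sign (of_nat n) = (-1) ^ n"
  by (induction n) simp_all

lemma range_bit_sign: "range bit_sign = {1, -1}"
  by (auto simp: bit_sign_def image_iff intro: exI[of _ 0] exI[of _ 1])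

lemma of_nat_eq_bitI: "of_nat m = (of_nat n :: bit)" if "m + 2 * k = n"
  using that by auto

text \<open>Inclusion and exclusion for a symmetric difference of supports. The set \<open>S\<close>
  lets one identity serve three levels: \<open>UNIV\<close>, the support of one vector and the
  intersection of two supports.\<close>

lemma card_supp_add:
  fixes u v :: "bit ^ 'm"
  shows "card (supp (u + v) \<inter> S) + 2 * card (supp u \<inter> supp v \<inter> S) =
    card (supp u \<inter> S) + card (supp v \<inter> S)"
proof -
  have iff: "a + b = 1 \<longleftrightarrow> (a = 1) \<noteq> (b = 1)" for a b :: bit
    by (cases a; cases b) simp_all
  let ?D = "supp (u + v) \<inter> S" and ?U = "supp u \<inter> S" and ?V = "supp v \<inter> S"
  have "card (?U \<union> ?V) + card (?U \<inter> ?V) = card ?U + card ?V"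
    by (rule card_Un_Int[symmetric]) simp_all
  moreover have "card (?U \<union> ?V) = card ?D + card (?U \<inter> ?V)"
    by (subst card_Un_disjoint[symmetric]) (auto simp: supp_def iff intro!: arg_cong[of _ _ card])
  moreover have "?U \<inter> ?V = supp u \<inter> supp v \<inter> S"
    by auto
  ultimately show ?thesis by simp
qed

text \<open>Modulo 2, one quarter of a weight, one half of a pairwise intersection and a triple
  intersection arise from each other by polarization, so \<open>q\<close> is cubic. The identities
  for \<open>\<phi>\<close> become additive ones for its exponent \<open>\<psi>\<close>.\<close>

lemma code_loop_cubic_extension:
  fixes V :: "(bit ^ 'm) set"
  assumes "code_loop V L z"
  obtains q \<tau> \<psi> el where "cubic_extension V q \<tau> \<psi> L el" "el 1 0 = z"
proof -
  from assms obtain \<phi> h where L: "loop L" and V: "double_even_code V" and \<phi>: "factor_set V \<phi>"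
    and h: "h \<in> iso (loop_of_code V \<phi>) L" and z: "h (-1, 0) = z"
    unfolding code_loop_def by blast
  define q :: "bit ^ 'm \<Rightarrow> bit" where "q v = of_nat (card (supp v) div 4)" for v
  define \<beta> :: "bit ^ 'm \<Rightarrow> bit ^ 'm \<Rightarrow> bit" where "\<beta> u v = of_nat (card (supp u \<inter> supp v) div 2)" for u v
  define \<tau> :: "bit ^ 'm \<Rightarrow> bit ^ 'm \<Rightarrow> bit ^ 'm \<Rightarrow> bit"
    where "\<tau> u v w = of_nat (card (supp u \<inter> supp v \<inter> supp w))" for u v w
  define \<psi> :: "bit ^ 'm \<Rightarrow> bit ^ 'm \<Rightarrow> bit" where "\<psi> v w = of_bool (\<phi> v w = -1)" for v w
  define el where "el e v = h (bit_sign e, v)" for e v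
  have subspace: "vec.subspace V"
    and four: "\<And>v. v \<in> V \<Longrightarrow> 4 dvd card (supp v)"
    and two: "\<And>v w. v \<in> V \<Longrightarrow> w \<in> V \<Longrightarrow> 2 dvd card (supp v \<inter> supp w)"
    using V unfolding double_even_code_def by blast+
  note [simp] = vec.subspace_add[OF subspace] vec.subspace_0[OF subspace]
  have \<tau>_add: "\<tau> (u + x) v w = \<tau> u v w + \<tau> x v w" for u v w x
  proof -
    have "\<tau> (u + x) v w = of_nat (card (supp u \<inter> supp v \<inter> supp w) + card (supp x \<inter> supp v \<inter> supp w))"
      unfolding \<tau>_def by (rule of_nat_eq_bitI) (rule card_supp_add[of u x "supp v \<inter> supp w", unfolded Int_assoc[symmetric]])
    then show ?thesis by (simp add: \<tau>_def)
  qed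
  have q_add: "q (u + v) = q u + q v + \<beta> u v" if "u \<in> V" "v \<in> V" for u v
  proof -
    have "card (supp (u + v)) + 2 * card (supp u \<inter> supp v) = card (supp u) + card (supp v)"
      using card_supp_add[of u v UNIV] by simp
    then have "card (supp (u + v)) div 4 + card (supp u \<inter> supp v) div 2 =
        card (supp u) div 4 + card (supp v) div 4"
      using four[of u] four[of v] four[of "u + v"] two[of u v] that by (auto elim!: dvdE)
    then have "q (u + v) + \<beta> u v = q u + q v"
      unfolding q_def \<beta>_def by (metis of_nat_add)
    then show ?thesis
      by (metis add.assoc add.commute bit_add_left_cancel)
  qed
  have \<beta>_add: "\<beta> (u + v) w = \<beta> u w + \<beta> v w + \<tau> u v w" if "u \<in> V" "v \<in> V" "w \<in> V" for u v w
  proof -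
    have "card (supp (u + v) \<inter> supp w) div 2 + card (supp u \<inter> supp v \<inter> supp w) =
        card (supp u \<inter> supp w) div 2 + card (supp v \<inter> supp w) div 2"
      using card_supp_add[of u v "supp w"] two[of u w] two[of v w] two[of "u + v" w] that
      by (auto elim!: dvdE)
    then have "\<beta> (u + v) w + \<tau> u v w = \<beta> u w + \<beta> v w"
      unfolding \<tau>_def \<beta>_def by (metis of_nat_add)
    then show ?thesis
      by (metis add.assoc add.commute bit_add_left_cancel)
  qed
  have \<phi>_range: "\<phi> v w \<in> {1, -1}" if "v \<in> V" "w \<in> V" for v w
    using \<phi> that unfolding factor_set_def by blast
  have \<phi>_sign: "\<phi> v w = bit_sign (\<psi> v w)" if "v \<in> V" "w \<in> V" for v w
    using \<phi>_range[OF that] by (auto simp: \<psi>_def bit_sign_def)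
  have \<phi>_diag: "\<phi> v v = bit_sign (q v)" if "v \<in> V" for v
    using \<phi> that unfolding factor_set_def q_def bit_sign_of_nat by blast
  have \<phi>_commute: "\<phi> v w = bit_sign (\<beta> v w) * \<phi> w v" if "v \<in> V" "w \<in> V" for v w
    using \<phi> that unfolding factor_set_def \<beta>_def bit_sign_of_nat by blast
  have \<phi>_0: "\<phi> 0 v = 1" "\<phi> v 0 = 1" if "v \<in> V" for v
    using \<phi> that unfolding factor_set_def by blast+
  have \<phi>_cocycle: "\<phi> (v + w) u = \<phi> v (w + u) * \<phi> v w * \<phi> w u * bit_sign (\<tau> v w u)"
    if "v \<in> V" "w \<in> V" "u \<in> V" for u v w
    using \<phi> that unfolding factor_set_def \<tau>_def bit_sign_of_nat by blast
  have bij: "bij_betw h ({1, -1} \<times> V) (carrier L)"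
    using h by (auto simp: iso_def loop_of_code_def)
  have sign_bij: "bij_betw (\<lambda>(e, v). (bit_sign e, v)) (UNIV \<times> V) ({1, -1} \<times> V)"
    unfolding bij_betw_def range_bit_sign[symmetric] by (auto simp: inj_on_def image_iff)
  have h_mult: "h (\<epsilon> * \<delta> * \<phi> v w, v + w) = h (\<epsilon>, v) \<otimes>\<^bsub>L\<^esub> h (\<delta>, w)"
    if "\<epsilon> \<in> {1, -1}" "\<delta> \<in> {1, -1}" "v \<in> V" "w \<in> V" for \<epsilon> \<delta> v w
    using h hom_mult[of h "loop_of_code V \<phi>" L "(\<epsilon>, v)" "(\<delta>, w)"] that
    by (auto simp: iso_def loop_of_code_def)
  have sign_mem: "bit_sign e \<in> {1, -1}" for e
    using range_bit_sign by blast
  have "cubic_extension V q \<tau> \<psi> L el"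
  proof
    show "bij_betw (\<lambda>(e, v). el e v) (UNIV \<times> V) (carrier L)"
      using bij_betw_trans[OF sign_bij bij] by (simp add: el_def comp_def case_prod_unfold)
    show "el e v \<otimes>\<^bsub>L\<^esub> el d w = el (e + d + \<psi> v w) (v + w)" if "v \<in> V" "w \<in> V" for e d v w
      using h_mult[OF sign_mem sign_mem that, of e d] that by (simp add: el_def \<phi>_sign)
    \<comment> \<open>Membership in \<open>iso\<close> does not mention units; again the image of
      the unit is idempotent, and left division identifies it.\<close>
    show "el 0 0 = \<one>\<^bsub>L\<^esub>"
    proof -
      have "h (1, 0) \<in> carrier L"
        using bij_betwE[OF bij] by simp
      moreover have "h (1, 0) \<otimes>\<^bsub>L\<^esub> h (1, 0) = h (1, 0)"
        using h_mult[of 1 1 0 0] \<phi>_0[of 0] by simp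
      ultimately show ?thesis
        using loop.left_division[OF L] loop.one_closed[OF L] loop.right_one[OF L]
        unfolding el_def bit_sign_simps by metis
    qed
    show "q (u + v + w) = q (u + v) + q (u + w) + q (v + w) + q u + q v + q w + \<tau> u v w"
      if "u \<in> V" "v \<in> V" "w \<in> V" for u v w
      using that by (simp add: q_add \<beta>_add)
    have sign_inj: "x = y" if "bit_sign x = bit_sign y" for x y
      using that by simp
    show "\<psi> v v = q v" if "v \<in> V" for v
      using \<phi>_diag[OF that] that by (intro sign_inj) (simp only: \<phi>_sign)
    show "\<psi> v w = \<psi> w v + (q (v + w) + q v + q w)" if "v \<in> V" "w \<in> V" for v w
    proof (rule sign_inj)
      have "q (v + w) + q v + q w = \<beta> v w"
        using that by (simp add: q_add add_ac)
      then show "bit_sign (\<psi> v w) = bit_sign (\<psi> w v + (q (v + w) + q v + q w))"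
        using \<phi>_commute[OF that] that by (simp only: \<phi>_sign bit_sign_simps mult.commute)
    qed
    show "\<psi> 0 v = 0" "\<psi> v 0 = 0" if "v \<in> V" for v
      using \<phi>_0[OF that] by (simp_all add: \<psi>_def)
    show "\<psi> (u + v) w = \<psi> u (v + w) + \<psi> u v + \<psi> v w + \<tau> u v w"
      if "u \<in> V" "v \<in> V" "w \<in> V" for u v w
    proof (rule sign_inj)
      show "bit_sign (\<psi> (u + v) w) = bit_sign (\<psi> u (v + w) + \<psi> u v + \<psi> v w + \<tau> u v w)"
        using \<phi>_cocycle[OF that] that
        by (simp only: \<phi>_sign bit_sign_simps vec.subspace_add[OF subspace])
    qed
  qed (use subspace \<tau>_add in simp_all)
  moreover have "el 1 0 = z"
    using z by (simp add: el_def)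
  ultimately show ?thesis by (rule that)
qed

section \<open>The form in the basis given by the generators\<close>

context cubic_extension
begin

text \<open>Translates the multiplicative notion of a basis of the quotient by the signs into linear
  coordinates on \<open>V\<close>; the coset \<open>K v\<close> corresponds to the vector
  \<open>v\<close>.\<close>

lemma generators3_el:
  assumes a: "a \<in> V" and b: "b \<in> V" and c: "c \<in> V"
    and gen: "generators3 L (el 1 0) (el e a) (el d b) (el g c)"
  shows "bij_betw (\<lambda>x :: bit ^ 3. x $ 1 *s a + x $ 2 *s b + x $ 3 *s c) UNIV V"
proof -
  define Q where "Q = L Mod {\<one>, el 1 0}"
  define K where "K v = {el 0 v, el 1 v}" for v
  have coset: "{\<one>, el 1 0} #> el e v = K v" if "v \<in> V" for e v
    using that by (cases e) (auto simp: r_coset_def K_def simp flip: el_one)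
  have K_carrier: "carrier Q = K ` V"
    unfolding Q_def carrier_FactGroup using coset by (force elim: el_cases simp: image_iff)
  have K_mult: "K v \<otimes>\<^bsub>Q\<^esub> K w = K (v + w)" if "v \<in> V" "w \<in> V" for v w
    using that by (cases "\<psi> v w") (auto simp: Q_def FactGroup_def set_mult_def K_def)
  have K_one: "\<one>\<^bsub>Q\<^esub> = K 0"
    by (simp add: Q_def K_def el_one)
  have K_inj: "inj_on K V"
    by (auto simp: inj_on_def K_def doubleton_eq_iff)
  have K_pow: "K v [^]\<^bsub>Q\<^esub> i = K (of_nat i *s v)" if "v \<in> V" "i \<in> {0, 1 :: nat}" for v i
    using that by (auto simp: K_one K_mult)
  let ?F = "\<lambda>(i :: nat, j :: nat, k :: nat). of_nat i *s a + of_nat j *s b + of_nat k *s c"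
  let ?I = "{0, 1 :: nat} \<times> {0, 1 :: nat} \<times> {0, 1 :: nat}"
  have smult: "x *s v \<in> V" if "v \<in> V" for x v
    using subspace that by (rule vec.subspace_scale)
  have "bij_betw (\<lambda>(i, j, k). (K a [^]\<^bsub>Q\<^esub> i \<otimes>\<^bsub>Q\<^esub> K b [^]\<^bsub>Q\<^esub> j) \<otimes>\<^bsub>Q\<^esub> K c [^]\<^bsub>Q\<^esub> k) ?I (K ` V)"
    using gen a b c unfolding generators3_def Let_def by (simp add: coset K_carrier flip: Q_def)
  then have "bij_betw (K \<circ> ?F) ?I (K ` V)"
    by (rule bij_betw_cong[THEN iffD1, rotated]) (auto simp: K_pow a b c K_mult K_one)
  then have KF: "inj_on (K \<circ> ?F) ?I" "K ` ?F ` ?I = K ` V"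
    by (auto simp: bij_betw_def image_comp)
  have "?F ` ?I \<subseteq> V"
    using a b c smult by auto
  then have "?F ` ?I = V"
    by (rule inj_on_image_eq_iff[THEN iffD1, OF K_inj _ subset_refl KF(2)])
  then have F: "bij_betw ?F ?I V"
    using inj_on_imageI2[OF KF(1)] by (simp add: bij_betw_def)
  \<comment> \<open>Exponents are natural numbers and coordinates are field elements;
    \<open>of_bool\<close> passes from the latter to the former.\<close>
  have of_bool: "of_bool (x = 1) = x" for x :: bit
    by (cases x) simp_all
  have "bij_betw (\<lambda>x :: bit ^ 3. (of_bool (x $ 1 = 1), of_bool (x $ 2 = 1), of_bool (x $ 3 = 1))) UNIV ?I"
    by (rule bij_betwI[where g = "\<lambda>(i, j, k). vector [of_nat i, of_nat j, of_nat k]"])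
      (auto simp: vec_eq_iff forall_3 of_bool)
  from bij_betw_trans[OF this F] show ?thesis
    by (simp add: comp_def of_bool)
qed

text \<open>An alternating trilinear form that vanishes on a spanning triple is zero, whereas some
  associator is nontrivial.\<close>

lemma \<tau>_basis_eq_1:
  assumes abc: "a \<in> V" "b \<in> V" "c \<in> V"
    and onto: "\<And>v. v \<in> V \<Longrightarrow> \<exists>x y z. v = x *s a + y *s b + z *s c"
    and "nonassociative L"
  shows "\<tau> a b c = 1"
proof (rule ccontr)
  assume "\<tau> a b c \<noteq> 1"
  then have perm: "\<tau> a b c = 0" "\<tau> a c b = 0" "\<tau> b a c = 0" "\<tau> b c a = 0" "\<tau> c a b = 0" "\<tau> c b a = 0"
    using abc \<tau>_swap(2)[of a b c] \<tau>_swap(1)[of a b c] \<tau>_swap(2)[of b a c] \<tau>_swap(1)[of a c b]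
      \<tau>_swap(2)[of c a b] by simp_all
  have self: "\<tau> u v u = 0" "\<tau> u u v = 0" if "u \<in> V" "v \<in> V" for u v
    using that \<tau>_self[of v u] \<tau>_swap(1)[of v u u] \<tau>_swap(2)[of u u v] by simp_all
  have base: "\<tau> u v w = 0" if "u \<in> {a, b, c}" "v \<in> {a, b, c}" "w \<in> {a, b, c}" for u v w
    using that abc by (auto simp: perm self \<tau>_self)
  have \<tau>_0: "\<tau> 0 v w = 0" if "v \<in> V" "w \<in> V" for v w
    using \<tau>_add[of 0 v w 0] that by simp
  \<comment> \<open>Linearity in the first argument; symmetry then moves each of the three arguments
    in turn into that place.\<close>
  have extend: "\<tau> u v w = 0"
    if "u \<in> V" "v \<in> V" "w \<in> V" and zero: "\<tau> a v w = 0" "\<tau> b v w = 0" "\<tau> c v w = 0" for u v w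
  proof -
    obtain x y z where "u = x *s a + y *s b + z *s c"
      using onto[OF \<open>u \<in> V\<close>] by blast
    then show ?thesis
      using that abc by (cases x; cases y; cases z) (simp_all add: \<tau>_add \<tau>_0)
  qed
  have V: "u \<in> V" if "u \<in> {a, b, c}" for u
    using that abc by auto
  have step1: "\<tau> u v w = 0" if "u \<in> V" "v \<in> {a, b, c}" "w \<in> {a, b, c}" for u v w
    using that V base by (intro extend[of u v w]) simp_all
  have step2: "\<tau> u v w = 0" if "u \<in> V" "v \<in> V" "w \<in> {a, b, c}" for u v w
  proof -
    have "\<tau> x v w = 0" if "x \<in> {a, b, c}" for x
      using step1[of v x w] \<tau>_swap(1)[of x v w] \<open>v \<in> V\<close> V[OF that] V[OF \<open>w \<in> {a, b, c}\<close>] that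
        \<open>w \<in> {a, b, c}\<close> by simp
    then show ?thesis
      using that V by (intro extend[of u v w]) simp_all
  qed
  have "\<tau> u v w = 0" if "u \<in> V" "v \<in> V" "w \<in> V" for u v w
  proof -
    have "\<tau> x v w = 0" if "x \<in> {a, b, c}" for x
      using step2[of v w x] \<tau>_swap(1)[of x v w] \<tau>_swap(2)[of v x w] \<open>v \<in> V\<close> \<open>w \<in> V\<close> V[OF that] that
      by simp
    then show ?thesis
      using that by (intro extend[of u v w]) simp_all
  qed
  then show False
    using \<open>nonassociative L\<close> unfolding nonassociative_iff by fastforce
qed

end

text \<open>The characteristic vector gives \<open>q\<close> on the generators and their pairwise
  sums, and polarization with \<open>\<tau> a b c = 1\<close> gives it on the triple sum. So
  \<open>q\<close> agrees with \<open>cubic_form l\<close> on all eight vectors.\<close>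

theorem Out_code_loop_rank3:
  fixes V :: "(bit ^ 'm) set"
  assumes "nonassoc_code_loop_rank3 l V L z"
  shows "Out L z \<cong> form_group l"
proof -
  obtain l1 l2 l3 l4 l5 l6 where l: "l = (l1, l2, l3, l4, l5, l6)"
    by (cases l)
  from assms obtain x y w where code: "code_loop V L z" and nonassoc: "nonassociative L"
    and gen: "generators3 L z x y w" and char: "has_characteristic_vector L z x y w l"
    unfolding nonassoc_code_loop_rank3_def by blast
  from code obtain q \<tau> \<psi> el where "cubic_extension V q \<tau> \<psi> L el" and z: "el 1 0 = z"
    by (rule code_loop_cubic_extension)
  then interpret cubic_extension V q \<tau> \<psi> L el
    by blast
  have "x \<in> carrier L" "y \<in> carrier L" "w \<in> carrier L"
    using gen by (simp_all add: generators3_def)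
  then obtain a b c e d g where abc: "a \<in> V" "b \<in> V" "c \<in> V"
    and xyw: "x = el e a" "y = el d b" "w = el g c"
    by (elim el_cases)
  define B :: "bit ^ 3 \<Rightarrow> bit ^ 'm" where "B x = x $ 1 *s a + x $ 2 *s b + x $ 3 *s c" for x
  have B_bij: "bij_betw B UNIV V"
    using generators3_el[OF abc] gen unfolding B_def xyw z by blast
  have B_linear: "Vector_Spaces.linear (*s) (*s) B"
    by (rule bit_linearI) (simp add: B_def vec.scale_left_distrib)
  have neg: "neg_one_power L z i = el i 0" for i
    using el_one z by (cases i) (simp_all add: neg_one_power_def)
  have squares: "q a = l1" "q b = l2" "q c = l3"
    and commutators: "q (a + b) = l4 + l1 + l2" "q (a + c) = l5 + l1 + l3" "q (b + c) = l6 + l2 + l3"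
    using char abc by (auto simp: l neg xyw commutator_el)
  have "\<tau> a b c = 1"
    using abc nonassoc bij_betw_imp_surj_on[OF B_bij] by (intro \<tau>_basis_eq_1) (auto simp: B_def)
  then have "q (a + b + c) = l1 + l2 + l3 + l4 + l5 + l6 + 1"
    by (simp only: q_polar[OF abc] squares commutators) (simp add: add_ac)
  then have "q (B x) = cubic_form l x" for x
    unfolding B_def l
    by (cases "x $ 1"; cases "x $ 2"; cases "x $ 3")
      (simp_all add: squares commutators add_ac)
  then have "Out L (el 1 0) \<cong> form_group l"
    using nonassoc B_linear B_bij by (intro Out_iso_form_group)
  then show ?thesis
    by (simp add: z)
qed

theorem proposition6:
  fixes V :: "(bit ^ 'm) set"
    and L :: "('a, 'b) monoid_scheme"
    and z :: 'a
  shows "(C3_1 V L z \<longrightarrow> Out L z \<cong> GL3_2) \<and>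
         (C3_2 V L z \<longrightarrow> Out L z \<cong> sym_group 4) \<and>
         (C3_3 V L z \<longrightarrow> Out L z \<cong> sym_group 4) \<and>
         (C3_4 V L z \<longrightarrow> Out L z \<cong> dihedral_group 4) \<and>
         (C3_5 V L z \<longrightarrow> Out L z \<cong> sym_group 3)"
proof (intro conjI impI)
  show "Out L z \<cong> GL3_2" if "C3_1 V L z"
    using Out_code_loop_rank3[OF that] by (simp only: form_group_111111)
  show "Out L z \<cong> sym_group 4" if "C3_2 V L z"
    by (rule iso_trans[OF Out_code_loop_rank3[OF that]
          iso_trans[OF form_group_000000_iso form_group_000111]])
  show "Out L z \<cong> sym_group 4" if "C3_3 V L z"
    by (rule iso_trans[OF Out_code_loop_rank3[OF that] form_group_000111])
  show "Out L z \<cong> dihedral_group 4" if "C3_4 V L z"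
    by (rule iso_trans[OF Out_code_loop_rank3[OF that] form_group_110000])
  show "Out L z \<cong> sym_group 3" if "C3_5 V L z"
    by (rule iso_trans[OF Out_code_loop_rank3[OF that] form_group_100000])
qed

end
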